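(* Let $(\tau_n)_{n\in\mathbb{N}}$ be, for each $\delta$, a random walk with $\tau_0=0$ and i.i.d. increments distributed as $\tau$, where $\mathsf{E}[\tau]=\delta\in(0,\infty)$ and $\mathsf{Var}[\tau]<\infty$, and let $\nu(t)=\inf\{n\in\mathbb{N}:\tau_n>t\}$ for $t>0$. Let $r\ge 1$ and suppose that, as $\delta\to\infty$, $$\mathsf{E}[|\tau-\delta|^{r\vee 2}]=O(\delta^{r\vee 2})\quad\text{and}\quad \mathsf{E}[(\tau^+)^{r+1}]=O(\delta^{r+1}).$$ Then $$\frac{\delta\,\nu(t)}{t}\longrightarrow 1\quad\text{in } L^r\quad\text{as }\delta,t\to\infty\text{ so that }\delta=o(t).$$ If, in particular, $\mathsf{E}[|\tau-\delta|^{r\vee 2}]=\Theta(\delta^{q_{r\vee 2}})$ with $q_{r\vee 2}\in[0,r\vee 2]$, then, as $\delta,t\to\infty$ so that $\delta=o(t)$, $$\mathsf{E}\Bigl[\Bigl|\frac{\delta\,\nu(t)}{t}-1\Bigr|^r\Bigr]=O\Bigl(\frac{\delta}{t}\Bigr)^{r}+O\Bigl(\frac{\delta^{\alpha_r}}{t}\Bigr)^{r/2},\qquad \alpha_r:=\frac{2\,q_{r\vee 2}}{r\vee 2}-1.$$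
   Context: For each value of the drift $\delta>0$ (along values tending to infinity) there is a random walk $(\tau_n)_{n\in\mathbb{N}}$, $\tau_0:=0$, whose increments $(\tau_n-\tau_{n-1})$ are i.i.d. copies of $\tau:=\tau_1$; the law of $\tau$ depends on $\delta$, and $\tau$ is not necessarily positive. Order statements "as $\delta\to\infty$" refer to this family of laws. Notation: $x^+=\max\{x,0\}$ and $r\vee 2=\max\{r,2\}$; $O(x)^{a}$ denotes $(O(x))^a$. A statement "as $\delta,t\to\infty$ so that $\delta=o(t)$" refers to any joint limit in which $\delta\to\infty$, $t\to\infty$ and $\delta/t\to0$. *)

theory Defs
  imports "HOL-Probability.Probability" "HOL-Library.Landau_Symbols"
begin

text \<open>The starting point is 0 and \<open>S 1\<close> is the generic increment, so the common law of the
  increments is the law of \<open>S 1\<close>. Measurability is part of \<open>indep_vars\<close>.\<close>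

definition random_walk :: "'a measure \<Rightarrow> (nat \<Rightarrow> 'a \<Rightarrow> real) \<Rightarrow> bool" where
  "random_walk M S \<longleftrightarrow>
     prob_space M \<and>
     (\<forall>\<omega>\<in>space M. S 0 \<omega> = 0) \<and>
     prob_space.indep_vars M (\<lambda>_. borel) (\<lambda>n \<omega>. S (Suc n) \<omega> - S n \<omega>) UNIV \<and>
     (\<forall>n. distr M borel (\<lambda>\<omega>. S (Suc n) \<omega> - S n \<omega>) = distr M borel (S 1))"

definition walk_with_drift :: "'a measure \<Rightarrow> (nat \<Rightarrow> 'a \<Rightarrow> real) \<Rightarrow> real \<Rightarrow> bool" where
  "walk_with_drift M S \<delta> \<longleftrightarrow>
     random_walk M S \<and>
     integrable M (S 1) \<and> prob_space.expectation M (S 1) = \<delta> \<and>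
     integrable M (\<lambda>\<omega>. (S 1 \<omega> - \<delta>)\<^sup>2)"

text \<open>The infimum is taken in \<^typ>\<open>enat\<close>, so it is \<open>\<infinity>\<close> if the level is never exceeded.\<close>

definition first_passage :: "(nat \<Rightarrow> 'a \<Rightarrow> real) \<Rightarrow> real \<Rightarrow> 'a \<Rightarrow> enat" where
  "first_passage S t \<omega> = (INF n\<in>{n. S n \<omega> > t}. enat n)"

text \<open>The moment \<open>E[|X|^p]\<close>, \<open>p > 0\<close>, of an extended real random variable, as an element of
  \<open>[0, \<infinity>]\<close>; infinite values of \<open>X\<close> contribute \<open>\<infinity>\<close>.\<close>

definition abs_moment :: "'a measure \<Rightarrow> real \<Rightarrow> ('a \<Rightarrow> ereal) \<Rightarrow> ennreal" where
  "abs_moment M p X =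
     (\<integral>\<^sup>+\<omega>. (if \<bar>X \<omega>\<bar> = \<infinity> then \<infinity> else ennreal (\<bar>real_of_ereal (X \<omega>)\<bar> powr p)) \<partial>M)"

text \<open>Convergence in \<open>L^p\<close> to a constant; each \<open>X i\<close> may live on its own probability space.\<close>

definition tendsto_Lp ::
    "real \<Rightarrow> ('i \<Rightarrow> 'a measure) \<Rightarrow> ('i \<Rightarrow> 'a \<Rightarrow> ereal) \<Rightarrow> real \<Rightarrow> 'i filter \<Rightarrow> bool" where
  "tendsto_Lp p M X c F \<longleftrightarrow>
     (\<forall>\<^sub>F i in F. X i \<in> borel_measurable (M i) \<and> abs_moment (M i) p (X i) < \<infinity>) \<and>
     ((\<lambda>i. abs_moment (M i) p (\<lambda>\<omega>. X i \<omega> - ereal c)) \<longlongrightarrow> 0) F"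

text \<open>\<open>\<delta> \<rightarrow> \<infinity>\<close> along the set \<open>D\<close> of admissible drifts.\<close>

definition drift_limit :: "real set \<Rightarrow> real filter" where
  "drift_limit D = inf at_top (principal D)"

text \<open>\<open>F\<close> is a joint limit of pairs \<open>(\<delta>, t)\<close>, with \<open>\<delta>\<close> in \<open>D\<close>, in which \<open>\<delta>, t \<rightarrow> \<infinity>\<close> so that
  \<open>\<delta> = o(t)\<close>.\<close>

definition joint_limit :: "real set \<Rightarrow> (real \<times> real) filter \<Rightarrow> bool" where
  "joint_limit D F \<longleftrightarrow>
     (\<forall>\<^sub>F (\<delta>, t) in F. \<delta> \<in> D) \<and>
     filterlim fst at_top F \<and> filterlim snd at_top F \<and>
     fst \<in> o[F](snd)"

definition scaled_passage :: "(real \<Rightarrow> nat \<Rightarrow> 'a \<Rightarrow> real) \<Rightarrow> real \<times> real \<Rightarrow> 'a \<Rightarrow> ereal" where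
  "scaled_passage S = (\<lambda>(\<delta>, t) \<omega>. ereal \<delta> * ereal_of_enat (first_passage (S \<delta>) t \<omega>) / ereal t)"

end

(* The moments of (nu - t/delta) are governed by the centred walk at the deterministic time
   n = floor (t/delta) alone. After normalising the increments to mean 1, put p = max r 2.
   If nu < n, the centred walk exceeds n - nu at time nu, and by optional stopping its p-th moment
   there is at most its p-th moment at time n. If nu > n, the Markov property at time n restarts the
   passage problem with a level bounded by the centred walk at time n plus 1, and a restart argument
   shows that the p-th moment of the passage time over a level x is O((x + 1)^p). Neither step
   sees the overshoot. A tangent-line inequality for |a + b|^p bounds the p-th moment of the centred
   walk at time n by a multiple of n^(p/2), and interpolation passes from p to r. *)

theory Submission
  imports Defs
begin

subsection \<open>Tangent inequalities for powers\<close>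

text \<open>The restart argument bounds a moment of the passage time by moments of the same kind at
  random levels, which says nothing while these might be infinite. Hence passage times are capped at
  N: a restart lowers the cap, induction on N closes, and monotone convergence then yields the
  moment bound and almost sure finiteness together. Restarts happen at deterministic times only, so
  on the canonical space of increment sequences the Markov property is Fubini's theorem for joined
  sequences. Optional stopping is likewise a finite sum over the values j < n of the capped passage
  time. The two rates have separate sources. With T = t/delta and s the normalised p-th moment of a
  step, the p-th moment of nu - T is at most a constant times (b + 1)^p + s T^(p/2). The shift b
  only has to dominate a power of s, and s is bounded by hypothesis, so b is a constant and leads to
  (delta/t)^r. Keeping s itself in the second term turns the finer order delta^q into the exponent
  alpha.\<close>

lemma powr_add_le:
  fixes a b p :: real
  assumes "0 \<le> a" "0 \<le> b" "0 \<le> p"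
  shows "(a + b) powr p \<le> 2 powr p * (a powr p + b powr p)"
proof -
  have "(a + b) powr p \<le> (2 * max a b) powr p"
    using assms by (intro powr_mono2) auto
  also have "\<dots> = 2 powr p * max a b powr p"
    using assms by (simp add: powr_mult)
  also have "max a b powr p \<le> a powr p + b powr p"
    by (auto simp: max_def)
  finally show ?thesis by simp
qed

lemma powr_above_tangent_pos:
  fixes a c p :: real
  assumes "1 \<le> p" "0 < a" "0 < c"
  shows "a powr p + p * a powr (p - 1) * (c - a) \<le> c powr p"
proof -
  have "p * a powr (p - 1) * (c - a) \<le> c powr p - a powr p"
    using assms
    by (intro convex_on_imp_above_tangent[OF powr_convex])
       (auto intro!: derivative_eq_intros simp: interior_open connected_Ioi)
  then show ?thesis by simp
qed

text \<open>Convexity of |x|^p, in the form from which conditional Jensen will follow: when a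
  centred \<open>b\<close> is integrated, the linear term vanishes. Only a > 0 needs an argument; a
  < 0 is its reflection.\<close>

lemma abs_powr_above_tangent:
  fixes a b p :: real
  assumes "1 \<le> p"
  shows "\<bar>a\<bar> powr p + p * \<bar>a\<bar> powr (p - 1) * sgn a * b \<le> \<bar>a + b\<bar> powr p"
proof -
  have pos: "a powr p + p * a powr (p - 1) * b \<le> \<bar>a + b\<bar> powr p" if "0 < a" for a b :: real
  proof (cases "0 < a + b")
    case True
    then show ?thesis
      using powr_above_tangent_pos[OF assms \<open>0 < a\<close>, of "a + b"] by simp
  next
    case False
    \<comment> \<open>Once a + b <= 0, the tangent line has dropped to at most (1 - p) a^p <= 0 and
      lies below any power.\<close>
    then have "p * a powr (p - 1) * b \<le> p * a powr (p - 1) * (-a)"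
      using assms that by (intro mult_left_mono) auto
    also have "\<dots> = - (p * a powr p)"
      using that powr_add[of a "p - 1" 1] by simp
    also have "\<dots> \<le> - (a powr p)"
      using assms mult_right_mono[of 1 p "a powr p"] by simp
    finally show ?thesis
      using powr_ge_zero[of "\<bar>a + b\<bar>" p] by linarith
  qed
  consider "a < 0" | "a = 0" | "0 < a" by linarith
  then show ?thesis
  proof cases
    case 1
    have "\<bar>- a + - b\<bar> = \<bar>a + b\<bar>" by linarith
    with pos[of "- a" "- b"] 1 show ?thesis by simp
  qed (use pos[of a b] in auto)
qed

lemma power2_powr:
  fixes a q :: real
  shows "(a\<^sup>2) powr (q / 2) = \<bar>a\<bar> powr q"
proof -
  have "(\<bar>a\<bar> powr 2) powr (q / 2) = \<bar>a\<bar> powr (2 * (q / 2))"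
    by (rule powr_powr)
  then show ?thesis by simp
qed

text \<open>Young's inequality with weights adapted to n steps: a factor 1 + c/n per step compounds
  to at most e^c, while n contributions of order n^(p/2 - 1) add up to n^(p/2). The cases compare
  |b| with |a| / sqrt n, and each uses a single term on the right.\<close>

lemma powr_mult_square_le:
  fixes a b p n :: real
  assumes "2 \<le> p" "1 \<le> n"
  shows "\<bar>a\<bar> powr (p - 2) * b\<^sup>2 \<le> \<bar>a\<bar> powr p / n + n powr (p / 2 - 1) * \<bar>b\<bar> powr p"
proof (cases "n * b\<^sup>2 \<le> \<bar>a\<bar>\<^sup>2")
  case True
  then have "\<bar>a\<bar> powr (p - 2) * b\<^sup>2 \<le> \<bar>a\<bar> powr (p - 2) * (\<bar>a\<bar>\<^sup>2 / n)"
    using assms by (intro mult_left_mono) (auto simp: field_simps)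
  also have "\<dots> = \<bar>a\<bar> powr p / n"
    using powr_add[of "\<bar>a\<bar>" "p - 2" 2] by (cases "a = 0") auto
  finally show ?thesis
    by (smt (verit) mult_nonneg_nonneg powr_ge_zero)
next
  case False
  then have "b \<noteq> 0" by auto
  have "\<bar>a\<bar> powr (p - 2) = (\<bar>a\<bar>\<^sup>2) powr (p / 2 - 1)"
    using power2_powr[of a "p - 2"] by (simp add: diff_divide_distrib)
  also have "\<dots> \<le> (n * b\<^sup>2) powr (p / 2 - 1)"
    using False assms by (intro powr_mono2) auto
  also have "\<dots> = n powr (p / 2 - 1) * \<bar>b\<bar> powr (p - 2)"
    using assms power2_powr[of b "p - 2"] by (simp add: powr_mult diff_divide_distrib)
  finally have "\<bar>a\<bar> powr (p - 2) * b\<^sup>2 \<le> n powr (p / 2 - 1) * \<bar>b\<bar> powr (p - 2) * b\<^sup>2"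
    by (intro mult_right_mono) auto
  also have "\<dots> = n powr (p / 2 - 1) * \<bar>b\<bar> powr p"
    using powr_add[of "\<bar>b\<bar>" "p - 2" 2] \<open>b \<noteq> 0\<close> by auto
  finally show ?thesis
    using assms by (smt (verit) divide_nonneg_nonneg powr_ge_zero)
qed

text \<open>The summand p^2 2^p dominates the second-order coefficient p (p - 1) 2^(p - 2) when |b|
  is small against |a|, and the linear term, at most p 2^(p - 1) |b|^p, when |a| <= 2 |b|. In the
  latter case 3^p comes from |a + b| <= 3 |b|.\<close>

definition tangent_const :: "real \<Rightarrow> real" where
  "tangent_const p = p\<^sup>2 * 2 powr p + 3 powr p"

lemma tangent_const_pos: "0 < tangent_const p"
  unfolding tangent_const_def by (intro add_nonneg_pos) auto

text \<open>For |a| <= 2 |b| every term is of order |b|^p. Otherwise this is a second-order Taylor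
  bound, obtained from first-order convexity used twice: for the power p at a + b, then for the
  power p - 1, which is convex because p >= 2.\<close>

lemma abs_powr_le_tangent_square:
  fixes a b p :: real
  assumes p: "2 \<le> p"
  shows "\<bar>a + b\<bar> powr p \<le> \<bar>a\<bar> powr p + p * \<bar>a\<bar> powr (p - 1) * sgn a * b
    + tangent_const p * (\<bar>a\<bar> powr (p - 2) * b\<^sup>2 + \<bar>b\<bar> powr p)"
proof -
  have large: ?thesis if ab: "\<bar>a\<bar> \<le> 2 * \<bar>b\<bar>"
  proof -
    have 1: "\<bar>a + b\<bar> powr p \<le> 3 powr p * \<bar>b\<bar> powr p"
    proof -
      have "\<bar>a + b\<bar> powr p \<le> (3 * \<bar>b\<bar>) powr p"
        using p ab by (intro powr_mono2) auto
      then show ?thesis using p by (simp add: powr_mult)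
    qed
    have "- (p * \<bar>a\<bar> powr (p - 1) * sgn a * b) \<le> p * \<bar>a\<bar> powr (p - 1) * \<bar>b\<bar>"
    proof -
      have "- (sgn a * b) \<le> \<bar>b\<bar>" by (auto simp: sgn_if)
      from mult_left_mono[OF this, of "p * \<bar>a\<bar> powr (p - 1)"] p show ?thesis by (simp add: mult.assoc)
    qed
    also have "\<bar>a\<bar> powr (p - 1) \<le> (2 * \<bar>b\<bar>) powr (p - 1)"
      using p ab by (intro powr_mono2) auto
    also have "(2 * \<bar>b\<bar>) powr (p - 1) = 2 powr (p - 1) * \<bar>b\<bar> powr (p - 1)"
      by (simp add: powr_mult)
    finally have "- (p * \<bar>a\<bar> powr (p - 1) * sgn a * b) \<le> p * (2 powr (p - 1) * \<bar>b\<bar> powr (p - 1)) * \<bar>b\<bar>"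
      using p by (simp add: mult_left_mono mult_right_mono)
    also have "\<dots> = p * 2 powr (p - 1) * \<bar>b\<bar> powr p"
      using powr_add[of "\<bar>b\<bar>" "p - 1" 1] by simp
    also have "\<dots> \<le> p\<^sup>2 * 2 powr p * \<bar>b\<bar> powr p"
    proof -
      have "p * 2 powr (p - 1) \<le> p\<^sup>2 * 2 powr p"
        using p by (intro mult_mono) (auto simp: power2_eq_square)
      then show ?thesis by (intro mult_right_mono) auto
    qed
    finally have "- (p * \<bar>a\<bar> powr (p - 1) * sgn a * b) \<le> p\<^sup>2 * 2 powr p * \<bar>b\<bar> powr p" .
    moreover have "0 \<le> tangent_const p * (\<bar>a\<bar> powr (p - 2) * b\<^sup>2)"
      using tangent_const_pos[of p] by simp
    moreover have "tangent_const p * (\<bar>a\<bar> powr (p - 2) * b\<^sup>2 + \<bar>b\<bar> powr p)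
      = tangent_const p * (\<bar>a\<bar> powr (p - 2) * b\<^sup>2) + p\<^sup>2 * 2 powr p * \<bar>b\<bar> powr p + 3 powr p * \<bar>b\<bar> powr p"
      by (simp add: tangent_const_def algebra_simps)
    ultimately show ?thesis
      using 1 powr_ge_zero[of "\<bar>a\<bar>" p] by linarith
  qed
  have small: "\<bar>a + b\<bar> powr p \<le> a powr p + p * a powr (p - 1) * b
      + tangent_const p * (a powr (p - 2) * b\<^sup>2 + \<bar>b\<bar> powr p)"
    if "0 < a" "2 * \<bar>b\<bar> < a" for a b :: real
  proof -
    define c where "c = a + b"
    have c: "0 < c" "c < 2 * a"
      using that by (auto simp: c_def abs_if split: if_splits)
    \<comment> \<open>The increment of the power p - 1 is bounded by a tangent at whichever end
      point gives the right sign: at c if b >= 0, at a if b < 0. Either slope is at most the slope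
      at 2 a.\<close>
    have *: "p * (c powr (p - 1) - a powr (p - 1)) * b \<le> p * ((p - 1) * ((2 * a) powr (p - 2)) * b) * b"
    proof (cases "0 \<le> b")
      case True
      have "c powr (p - 1) - a powr (p - 1) \<le> (p - 1) * c powr (p - 2) * b"
        using powr_above_tangent_pos[of "p - 1" c a] c that p by (simp add: c_def algebra_simps)
      also have "\<dots> \<le> (p - 1) * (2 * a) powr (p - 2) * b"
        using True p c by (intro mult_right_mono mult_left_mono powr_mono2) auto
      finally show ?thesis
        using True p by (intro mult_right_mono mult_left_mono) auto
    next
      case False
      have "(p - 1) * (2 * a) powr (p - 2) * b \<le> (p - 1) * a powr (p - 2) * b"
        using False p that by (intro mult_right_mono_neg mult_left_mono powr_mono2) auto
      also have "\<dots> \<le> c powr (p - 1) - a powr (p - 1)"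
        using powr_above_tangent_pos[of "p - 1" a c] c that p by (simp add: c_def algebra_simps)
      finally show ?thesis
        using False p by (intro mult_right_mono_neg mult_left_mono) auto
    qed
    also have "\<dots> = p * (p - 1) * 2 powr (p - 2) * (a powr (p - 2) * b\<^sup>2)"
      using that by (simp add: powr_mult power2_eq_square algebra_simps)
    also have "\<dots> \<le> tangent_const p * (a powr (p - 2) * b\<^sup>2)"
    proof (intro mult_right_mono)
      have "p * (p - 1) * 2 powr (p - 2) \<le> p\<^sup>2 * 2 powr p"
        using p by (intro mult_mono) (auto simp: power2_eq_square)
      then show "p * (p - 1) * 2 powr (p - 2) \<le> tangent_const p"
        by (simp add: tangent_const_def add_increasing2)
    qed auto
    finally have "p * c powr (p - 1) * b \<le> p * a powr (p - 1) * b + tangent_const p * (a powr (p - 2) * b\<^sup>2)"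
      by (simp add: algebra_simps)
    \<comment> \<open>The tangent is taken at c and evaluated at a. Its slope involves
      \<open>c powr (p - 1)\<close>, which the preceding inequality trades for
      \<open>a powr (p - 1)\<close>.\<close>
    moreover have "c powr p \<le> a powr p + p * c powr (p - 1) * b"
      using powr_above_tangent_pos[of p c a] c that p by (simp add: c_def algebra_simps)
    moreover have "0 \<le> tangent_const p * \<bar>b\<bar> powr p"
      using tangent_const_pos[of p] by simp
    moreover have "\<bar>a + b\<bar> = c" using c by (simp add: c_def)
    ultimately show ?thesis by (simp add: algebra_simps)
  qed
  show ?thesis
  proof (cases "\<bar>a\<bar> \<le> 2 * \<bar>b\<bar>")
    case False
    show ?thesis
    proof (cases "0 < a")
      case True
      with small[of a b] False show ?thesis by simp
    next
      case neg: False
      have "\<bar>- a + - b\<bar> = \<bar>a + b\<bar>" by linarith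
      with small[of "- a" "- b"] neg False show ?thesis by simp
    qed
  qed (rule large)
qed

text \<open>The one-step form: a is the walk so far and b the next step, so the linear term has mean
  zero and what remains is a recursion for the p-th moment.\<close>

lemma abs_powr_le_tangent:
  fixes a b p n :: real
  assumes p: "2 \<le> p" and n: "1 \<le> n"
  shows "\<bar>a + b\<bar> powr p \<le> (1 + tangent_const p / n) * \<bar>a\<bar> powr p
    + p * \<bar>a\<bar> powr (p - 1) * sgn a * b + 2 * tangent_const p * n powr (p / 2 - 1) * \<bar>b\<bar> powr p"
proof -
  have "1 \<le> n powr (p / 2 - 1)"
    using p n by (intro ge_one_powr_ge_zero) auto
  then have "\<bar>b\<bar> powr p \<le> n powr (p / 2 - 1) * \<bar>b\<bar> powr p"
    by (simp add: mult_le_cancel_right1)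
  with powr_mult_square_le[OF p n, of a b]
  have "\<bar>a\<bar> powr (p - 2) * b\<^sup>2 + \<bar>b\<bar> powr p
      \<le> \<bar>a\<bar> powr p / n + 2 * n powr (p / 2 - 1) * \<bar>b\<bar> powr p"
    by simp
  from mult_left_mono[OF this, of "tangent_const p"] abs_powr_le_tangent_square[OF p, of a b]
  show ?thesis
    using tangent_const_pos[of p] by (simp add: algebra_simps)
qed

subsection \<open>Moments of centred walks\<close>

text \<open>The sample point is itself the sequence of centred increments, so that joining two paths
  at time m is \<open>comb_seq m\<close>.\<close>

definition walk :: "nat \<Rightarrow> (nat \<Rightarrow> real) \<Rightarrow> real" where
  "walk k \<omega> = (\<Sum>i<k. \<omega> i)"

lemma walk_0 [simp]: "walk 0 \<omega> = 0"
  by (simp add: walk_def)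

lemma walk_Suc: "walk (Suc k) \<omega> = walk k \<omega> + \<omega> k"
  by (simp add: walk_def)

lemma walk_comb_seq_le: "k \<le> m \<Longrightarrow> walk k (comb_seq m \<omega> \<omega>') = walk k \<omega>"
  by (simp add: walk_def comb_seq_def)

lemma walk_comb_seq_add: "walk (m + k) (comb_seq m \<omega> \<omega>') = walk m \<omega> + walk k \<omega>'"
  proof (induction k)
  case 0
  then show ?case by (simp add: walk_comb_seq_le)
next
  case (Suc k)
  then show ?case by (simp add: walk_Suc) (simp add: comb_seq_def)
qed

lemma measurable_walk [measurable]:
  "walk k \<in> borel_measurable (PiM UNIV (\<lambda>_. borel))"
  unfolding walk_def by measurable

text \<open>The disjunct \<open>k = N\<close> makes the least element exist on every path, so this
  is the minimum of N and the passage time even where the level is never exceeded. The drift,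
  normalised to 1 per step, is added back as \<open>+ k\<close>.\<close>

definition passage_upto :: "nat \<Rightarrow> real \<Rightarrow> (nat \<Rightarrow> real) \<Rightarrow> nat" where
  "passage_upto N x \<omega> = (LEAST k. k = N \<or> walk k \<omega> + k > x)"

lemma measurable_passage_upto [measurable]:
  "passage_upto N x \<in> PiM UNIV (\<lambda>_. borel) \<rightarrow>\<^sub>M count_space UNIV"
  unfolding passage_upto_def by measurable

lemma passage_upto_le: "passage_upto N x \<omega> \<le> N"
  unfolding passage_upto_def by (rule Least_le) simp

lemma passage_upto_cases: "passage_upto N x \<omega> = N \<or> walk (passage_upto N x \<omega>) \<omega> + passage_upto N x \<omega> > x"
  unfolding passage_upto_def by (rule LeastI[where k = N]) simp

lemma passage_upto_leI: "walk k \<omega> + k > x \<Longrightarrow> passage_upto N x \<omega> \<le> k"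
  unfolding passage_upto_def by (rule Least_le) simp

lemma passage_upto_eq_iff:
  assumes "j < N"
  shows "passage_upto N x \<omega> = j \<longleftrightarrow> walk j \<omega> + j > x \<and> (\<forall>i<j. walk i \<omega> + i \<le> x)"
proof
  assume j: "passage_upto N x \<omega> = j"
  then show "walk j \<omega> + j > x \<and> (\<forall>i<j. walk i \<omega> + i \<le> x)"
    using passage_upto_cases[of N x \<omega>] passage_upto_leI[of x _ \<omega> N] assms by (force simp: not_less)
next
  assume "walk j \<omega> + j > x \<and> (\<forall>i<j. walk i \<omega> + i \<le> x)"
  then show "passage_upto N x \<omega> = j"
    using passage_upto_cases[of N x \<omega>] passage_upto_leI[of x j \<omega> N] assms
    by (metis leD le_neq_implies_less order_less_le_trans nless_le)
qed

lemma passage_upto_mono: "incseq (\<lambda>N. passage_upto N x \<omega>)"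
proof (rule incseq_SucI)
  fix N
  show "passage_upto N x \<omega> \<le> passage_upto (Suc N) x \<omega>"
    using passage_upto_cases[of "Suc N" x \<omega>] passage_upto_leI[of x _ \<omega> N] passage_upto_le[of N x \<omega>]
    by fastforce
qed

lemma passage_upto_neg: "x < 0 \<Longrightarrow> passage_upto N x \<omega> = 0"
  using passage_upto_leI[of x 0 \<omega> N] by simp

text \<open>When the restarted walk exceeds the residual level, the joined walk exceeds x. This is
  only an inequality, since the joined walk may have crossed x before time m. A negative residual
  level is harmless: its passage time is 0.\<close>

lemma passage_upto_comb_seq_le:
  assumes "N \<le> m + N'"
  shows "passage_upto N x (comb_seq m \<omega> \<omega>') \<le> m + passage_upto N' (x - m - walk m \<omega>) \<omega>'"
proof (cases "passage_upto N' (x - m - walk m \<omega>) \<omega>' = N'")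
  case True
  then show ?thesis using assms passage_upto_le[of N x "comb_seq m \<omega> \<omega>'"] by simp
next
  case False
  then show ?thesis
    using passage_upto_cases[of N' "x - m - walk m \<omega>" \<omega>']
    by (intro passage_upto_leI) (simp add: walk_comb_seq_add)
qed

section \<open>Relation between capped and uncapped passage times\<close>

lemma first_passage_enat:
  assumes "first_passage (\<lambda>n \<omega>. walk n \<omega> + real n) x \<omega> = enat k"
  shows "passage_upto N x \<omega> = min k N"
proof -
  let ?A = "{n. walk n \<omega> + real n > x}"
  have "enat ` ?A \<noteq> {}"
    using assms by (auto simp: first_passage_def Inf_enat_def split: if_splits)
  then obtain a where a: "a \<in> ?A" by auto
  have "first_passage (\<lambda>n \<omega>. walk n \<omega> + real n) x \<omega> \<in> enat ` ?A"
    using a unfolding first_passage_def by (intro wellorder_InfI) auto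
  with assms have k: "walk k \<omega> + real k > x" by auto
  have min: "walk i \<omega> + real i \<le> x" if "i < k" for i
  proof (rule ccontr)
    assume "\<not> ?thesis"
    then have "first_passage (\<lambda>n \<omega>. walk n \<omega> + real n) x \<omega> \<le> enat i"
      unfolding first_passage_def by (intro INF_lower) auto
    with assms that show False by simp
  qed
  show ?thesis
  proof (cases "k < N")
    case True
    with k min show ?thesis by (simp add: passage_upto_eq_iff)
  next
    case False
    with min show ?thesis
      using passage_upto_cases[of N x \<omega>] passage_upto_le[of N x \<omega>]
      by (metis le_neq_implies_less linorder_not_less min.absorb2 order_less_le_trans)
  qed
qed

lemma first_passage_infinity:
  assumes "first_passage (\<lambda>n \<omega>. walk n \<omega> + real n) x \<omega> = \<infinity>"
  shows "passage_upto N x \<omega> = N"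
proof (rule ccontr)
  assume "\<not> ?thesis"
  then have "walk (passage_upto N x \<omega>) \<omega> + passage_upto N x \<omega> > x"
    using passage_upto_cases by blast
  then have "first_passage (\<lambda>n \<omega>. walk n \<omega> + real n) x \<omega> \<le> enat (passage_upto N x \<omega>)"
    unfolding first_passage_def by (intro INF_lower) auto
  with assms show False by simp
qed

lemma measurable_first_passage:
  assumes [measurable]: "\<And>n. S n \<in> borel_measurable M"
  shows "first_passage S t \<in> M \<rightarrow>\<^sub>M count_space UNIV"
proof -
  have eq: "first_passage S t \<omega> = (if \<exists>n. S n \<omega> > t then enat (LEAST n. S n \<omega> > t) else \<infinity>)" for \<omega>
  proof (cases "\<exists>n. S n \<omega> > t")
    case True
    then show ?thesis
      by (auto simp: first_passage_def intro!: antisym INF_lower INF_greatest intro: LeastI Least_le)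
  next
    case False
    then show ?thesis by (auto simp: first_passage_def top_enat_def)
  qed
  show ?thesis
    unfolding eq[abs_def] by measurable
qed

text \<open>With c = \<open>tangent_const p\<close>, the exponential bounds the compounded factor (1
  + c/n)^n, and 2 c is the coefficient of the step moment in the one-step inequality.\<close>

definition moment_const :: "real \<Rightarrow> real" where
  "moment_const p = 2 * tangent_const p * exp (tangent_const p)"

lemma moment_const_pos: "0 < moment_const p"
  using tangent_const_pos[of p] by (simp add: moment_const_def)

section \<open>Independent centred steps: Markov property and growth of the p-th moment\<close>

locale centered_steps = sequence_space \<mu> for \<mu> :: "real measure" +
  fixes p s :: real
  assumes sets_mu [measurable_cong]: "sets \<mu> = sets borel"
    and p_ge_2: "2 \<le> p"
    and integrable_step: "integrable \<mu> (\<lambda>x. x)"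
    and step_mean: "(\<integral>x. x \<partial>\<mu>) = 0"
    and integrable_step_powr: "integrable \<mu> (\<lambda>x. \<bar>x\<bar> powr p)"
    and step_moment: "(\<integral>x. \<bar>x\<bar> powr p \<partial>\<mu>) \<le> s"
begin

lemma sets_S [measurable_cong]: "sets S = sets (PiM UNIV (\<lambda>_. borel :: real measure))"
  by (intro sets_PiM_cong) (auto simp: sets_mu)

lemma s_nonneg: "0 \<le> s"
  using step_moment by (rule order_trans[rotated]) simp

text \<open>Markov property at the fixed time m: two independent sequences joined at m are again
  distributed as one, and Fubini separates past from future.\<close>

lemma nn_integral_comb_seq:
  assumes [measurable]: "f \<in> borel_measurable S"
  shows "(\<integral>\<^sup>+\<omega>. f \<omega> \<partial>S) = (\<integral>\<^sup>+\<omega>. \<integral>\<^sup>+\<omega>'. f (comb_seq m \<omega> \<omega>') \<partial>S \<partial>S)"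
proof -
  have "(\<integral>\<^sup>+\<omega>. f \<omega> \<partial>S) = (\<integral>\<^sup>+\<omega>. f \<omega> \<partial>distr (S \<Otimes>\<^sub>M S) S (\<lambda>(\<omega>, \<omega>'). comb_seq m \<omega> \<omega>'))"
    by (simp only: PiM_comb_seq)
  also have "\<dots> = (\<integral>\<^sup>+z. f (comb_seq m (fst z) (snd z)) \<partial>(S \<Otimes>\<^sub>M S))"
    by (subst nn_integral_distr) (auto simp: split_beta' intro!: measurable_comb_seq)
  also have "\<dots> = (\<integral>\<^sup>+\<omega>. \<integral>\<^sup>+\<omega>'. f (comb_seq m \<omega> \<omega>') \<partial>S \<partial>S)"
    by (subst P.nn_integral_fst[symmetric]) auto
  finally show ?thesis .
qed

lemma distr_component: "distr S \<mu> (\<lambda>\<omega>. \<omega> i) = \<mu>"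
  by (rule distr_PiM_component) (auto simp: M.prob_space_axioms)

lemma nn_integral_step_le:
  assumes "1 \<le> n"
  shows "(\<integral>\<^sup>+y. ennreal (\<bar>a + y\<bar> powr p) \<partial>\<mu>)
    \<le> ennreal ((1 + tangent_const p / n) * \<bar>a\<bar> powr p + 2 * tangent_const p * n powr (p / 2 - 1) * s)"
proof -
  define g where "g y = (1 + tangent_const p / n) * \<bar>a\<bar> powr p
    + p * \<bar>a\<bar> powr (p - 1) * sgn a * y + 2 * tangent_const p * n powr (p / 2 - 1) * \<bar>y\<bar> powr p" for y
  have le: "\<bar>a + y\<bar> powr p \<le> g y" for y
    unfolding g_def by (rule abs_powr_le_tangent[OF p_ge_2 assms])
  have g_int: "integrable \<mu> g"
    unfolding g_def[abs_def] using integrable_step integrable_step_powr by auto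
  have "(\<integral>\<^sup>+y. ennreal (\<bar>a + y\<bar> powr p) \<partial>\<mu>) \<le> (\<integral>\<^sup>+y. ennreal (g y) \<partial>\<mu>)"
    by (intro nn_integral_mono ennreal_leI le)
  also have "\<dots> = ennreal (\<integral>y. g y \<partial>\<mu>)"
    by (intro nn_integral_eq_integral g_int AE_I2) (rule order_trans[OF _ le], simp)
  also have "(\<integral>y. g y \<partial>\<mu>) = (1 + tangent_const p / n) * \<bar>a\<bar> powr p
      + 2 * tangent_const p * n powr (p / 2 - 1) * (\<integral>x. \<bar>x\<bar> powr p \<partial>\<mu>)"
    unfolding g_def[abs_def] using integrable_step integrable_step_powr step_mean
    by (simp add: M.prob_space)
  also have "\<dots> \<le> (1 + tangent_const p / n) * \<bar>a\<bar> powr p + 2 * tangent_const p * n powr (p / 2 - 1) * s"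
    using step_moment tangent_const_pos[of p] by (intro add_left_mono mult_left_mono) auto
  finally show ?thesis by (simp add: ennreal_leI)
qed

text \<open>The weight n stays fixed while k runs through the induction; k = n is set only
  afterwards. Each step multiplies by 1 + c/n and adds the same constant, and bounding all
  accumulated factors by the largest leaves k equal contributions.\<close>

lemma nn_integral_walk_aux:
  assumes n: "1 \<le> (n::real)"
  shows "(\<integral>\<^sup>+\<omega>. ennreal (\<bar>walk k \<omega>\<bar> powr p) \<partial>S)
    \<le> ennreal ((1 + tangent_const p / n) ^ k * k * (2 * tangent_const p * n powr (p / 2 - 1) * s))"
proof (induction k)
  case (Suc k)
  define D where "D = 2 * tangent_const p * n powr (p / 2 - 1) * s"
  define E where "E = 1 + tangent_const p / n"
  have D: "0 \<le> D" using tangent_const_pos[of p] s_nonneg by (simp add: D_def)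
  have E: "1 \<le> E" using tangent_const_pos[of p] n by (simp add: E_def)
  have "(\<integral>\<^sup>+\<omega>. ennreal (\<bar>walk (Suc k) \<omega>\<bar> powr p) \<partial>S)
      = (\<integral>\<^sup>+\<omega>. \<integral>\<^sup>+\<omega>'. ennreal (\<bar>walk (k + 1) (comb_seq k \<omega> \<omega>')\<bar> powr p) \<partial>S \<partial>S)"
    by (subst nn_integral_comb_seq[where m = k]) auto
  also have "\<dots> = (\<integral>\<^sup>+\<omega>. \<integral>\<^sup>+\<omega>'. ennreal (\<bar>walk k \<omega> + \<omega>' 0\<bar> powr p) \<partial>S \<partial>S)"
    by (simp only: walk_comb_seq_add) (simp add: walk_def)
  also have "\<dots> = (\<integral>\<^sup>+\<omega>. \<integral>\<^sup>+y. ennreal (\<bar>walk k \<omega> + y\<bar> powr p) \<partial>\<mu> \<partial>S)"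
  proof (intro nn_integral_cong)
    fix \<omega>
    have "(\<integral>\<^sup>+y. ennreal (\<bar>walk k \<omega> + y\<bar> powr p) \<partial>distr S \<mu> (\<lambda>\<omega>'. \<omega>' 0))
       = (\<integral>\<^sup>+\<omega>'. ennreal (\<bar>walk k \<omega> + \<omega>' 0\<bar> powr p) \<partial>S)"
      by (rule nn_integral_distr) auto
    then show "(\<integral>\<^sup>+\<omega>'. ennreal (\<bar>walk k \<omega> + \<omega>' 0\<bar> powr p) \<partial>S) = (\<integral>\<^sup>+y. ennreal (\<bar>walk k \<omega> + y\<bar> powr p) \<partial>\<mu>)"
      by (simp add: distr_component)
  qed
  also have "\<dots> \<le> (\<integral>\<^sup>+\<omega>. ennreal (E * \<bar>walk k \<omega>\<bar> powr p + D) \<partial>S)"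
    unfolding D_def E_def by (intro nn_integral_mono nn_integral_step_le n)
  also have "\<dots> = ennreal E * (\<integral>\<^sup>+\<omega>. ennreal (\<bar>walk k \<omega>\<bar> powr p) \<partial>S) + ennreal D"
    using E D by (simp add: ennreal_mult nn_integral_add nn_integral_cmult P.emeasure_space_1)
  also have "\<dots> \<le> ennreal E * ennreal (E ^ k * k * D) + ennreal D"
    unfolding D_def E_def by (intro add_right_mono mult_left_mono Suc.IH) auto
  also have "\<dots> = ennreal (E ^ Suc k * k * D + D)"
    using E D by (simp add: algebra_simps flip: ennreal_mult ennreal_plus)
  also have "\<dots> \<le> ennreal (E ^ Suc k * Suc k * D)"
  proof (rule ennreal_leI)
    have "1 * D \<le> E ^ Suc k * D"
      using E D by (intro mult_right_mono one_le_power) auto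
    then show "E ^ Suc k * k * D + D \<le> E ^ Suc k * Suc k * D"
      by (simp add: algebra_simps)
  qed
  finally show ?case by (simp add: D_def E_def)
qed auto

lemma nn_integral_walk_le:
  "(\<integral>\<^sup>+\<omega>. ennreal (\<bar>walk n \<omega>\<bar> powr p) \<partial>S) \<le> ennreal (moment_const p * s * n powr (p / 2))"
proof (cases "n = 0")
  case False
  then have "(\<integral>\<^sup>+\<omega>. ennreal (\<bar>walk n \<omega>\<bar> powr p) \<partial>S)
      \<le> ennreal ((1 + tangent_const p / n) ^ n * n * (2 * tangent_const p * n powr (p / 2 - 1) * s))"
    by (intro nn_integral_walk_aux) auto
  also have "\<dots> = ennreal ((1 + tangent_const p / n) ^ n * (2 * tangent_const p * s) * n powr (p / 2))"
    by (simp add: mult_ac flip: powr_mult_base[of n "p / 2 - 1", simplified])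
  also have "\<dots> \<le> ennreal (exp (tangent_const p) * (2 * tangent_const p * s) * n powr (p / 2))"
    using tangent_const_pos[of p] s_nonneg False
    by (intro ennreal_leI mult_right_mono exp_ge_one_plus_x_over_n_power_n) auto
  finally show ?thesis
    by (simp add: moment_const_def algebra_simps)
qed auto

lemma walk_integrable_mean:
  "integrable S (walk k)" "(\<integral>\<omega>. walk k \<omega> \<partial>S) = 0"
proof -
  have comp: "integrable S (\<lambda>\<omega>. \<omega> i) \<and> (\<integral>\<omega>. \<omega> i \<partial>S) = 0" for i
  proof
    show "integrable S (\<lambda>\<omega>. \<omega> i)"
      using integrable_step distr_component[of i]
        integrable_distr_eq[of "\<lambda>\<omega>. \<omega> i" S \<mu> "\<lambda>x. x"] by simp
    show "(\<integral>\<omega>. \<omega> i \<partial>S) = 0"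
      using step_mean distr_component[of i] integral_distr[of "\<lambda>\<omega>. \<omega> i" S \<mu> "\<lambda>x. x"] by simp
  qed
  show "integrable S (walk k)"
    unfolding walk_def[abs_def] using comp by auto
  show "(\<integral>\<omega>. walk k \<omega> \<partial>S) = 0"
    unfolding walk_def using comp by simp
qed

text \<open>Jensen's inequality conditionally on the past, with a the walk so far: the tangent line
  at a is integrated. With nonnegative integrals an infinite right-hand side is trivial, so
  integrability of the shifted power need not be shown beforehand.\<close>

lemma abs_powr_le_nn_integral_walk:
  "ennreal (\<bar>a\<bar> powr p) \<le> (\<integral>\<^sup>+\<omega>. ennreal (\<bar>a + walk k \<omega>\<bar> powr p) \<partial>S)"
proof (cases "(\<integral>\<^sup>+\<omega>. ennreal (\<bar>a + walk k \<omega>\<bar> powr p) \<partial>S) = \<infinity>")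
  case False
  then have int: "integrable S (\<lambda>\<omega>. \<bar>a + walk k \<omega>\<bar> powr p)"
    by (intro integrableI_nonneg) (auto simp: less_top)
  have "\<bar>a\<bar> powr p = (\<integral>\<omega>. \<bar>a\<bar> powr p + p * \<bar>a\<bar> powr (p - 1) * sgn a * walk k \<omega> \<partial>S)"
    using walk_integrable_mean[of k] by (simp add: P.prob_space)
  also have "\<dots> \<le> (\<integral>\<omega>. \<bar>a + walk k \<omega>\<bar> powr p \<partial>S)"
    using walk_integrable_mean[of k] p_ge_2
    by (intro integral_mono int abs_powr_above_tangent) auto
  finally have "ennreal (\<bar>a\<bar> powr p) \<le> ennreal (\<integral>\<omega>. \<bar>a + walk k \<omega>\<bar> powr p \<partial>S)"
    by (rule ennreal_leI)
  also have "\<dots> = (\<integral>\<^sup>+\<omega>. ennreal (\<bar>a + walk k \<omega>\<bar> powr p) \<partial>S)"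
    by (intro nn_integral_eq_integral[symmetric] int) auto
  finally show ?thesis .
qed simp

end

subsection \<open>Deviations of the first passage time\<close>

lemma nn_integral_powr_add_le:
  assumes [measurable]: "f \<in> borel_measurable M" and "\<And>\<omega>. 0 \<le> f \<omega>" "0 \<le> c" "0 \<le> p"
    and "prob_space M"
  shows "(\<integral>\<^sup>+\<omega>. ennreal ((c + f \<omega>) powr p) \<partial>M)
    \<le> ennreal (2 powr p) * (ennreal (c powr p) + (\<integral>\<^sup>+\<omega>. ennreal (f \<omega> powr p) \<partial>M))"
proof -
  interpret prob_space M by fact
  have "(\<integral>\<^sup>+\<omega>. ennreal ((c + f \<omega>) powr p) \<partial>M)
      \<le> (\<integral>\<^sup>+\<omega>. ennreal (2 powr p) * (ennreal (c powr p) + ennreal (f \<omega> powr p)) \<partial>M)"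
    using assms by (intro nn_integral_mono)
      (auto simp: simp flip: ennreal_mult ennreal_plus intro!: ennreal_leI powr_add_le)
  also have "\<dots> = ennreal (2 powr p) * (ennreal (c powr p) + (\<integral>\<^sup>+\<omega>. ennreal (f \<omega> powr p) \<partial>M))"
    by (simp add: nn_integral_cmult nn_integral_add emeasure_space_1)
  finally show ?thesis .
qed

context centered_steps
begin

text \<open>On the event that the passage happens at time \<open>j < n\<close> the centred walk exceeds \<open>n - j\<close> at
  time \<open>j\<close>, and by conditional Jensen its moment on this event can only grow up to time \<open>n\<close>.\<close>

lemma nn_integral_early_passage_le:
  assumes "real n \<le> x"
  shows "(\<integral>\<^sup>+\<omega>. ennreal (real (n - passage_upto n x \<omega>) powr p) \<partial>S)
    \<le> (\<integral>\<^sup>+\<omega>. ennreal (\<bar>walk n \<omega>\<bar> powr p) \<partial>S)"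
proof -
  let ?ev = "\<lambda>j \<omega>. indicator {\<omega>. passage_upto n x \<omega> = j} \<omega> :: ennreal"
  \<comment> \<open>The value n, no passage before time n, is left out of the sum: there
    \<open>n - passage_upto n x \<omega>\<close> is 0, and \<open>0 powr p\<close> is 0.\<close>
  have decomp: "(\<Sum>j<n. ?ev j \<omega> * c j) = (if passage_upto n x \<omega> < n then c (passage_upto n x \<omega>) else 0)"
    for \<omega> and c :: "nat \<Rightarrow> ennreal"
  proof (cases "passage_upto n x \<omega> < n")
    case True
    have "(\<Sum>j<n. ?ev j \<omega> * c j) = (\<Sum>j<n. if j = passage_upto n x \<omega> then c j else 0)"
      by (intro sum.cong) (auto simp: indicator_def)
    also have "\<dots> = c (passage_upto n x \<omega>)"
      using True by simp
    finally show ?thesis using True by simp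
  qed (auto intro!: sum.neutral simp: indicator_def)
  have step: "(\<integral>\<^sup>+\<omega>. ?ev j \<omega> * ennreal (real (n - j) powr p) \<partial>S)
      \<le> (\<integral>\<^sup>+\<omega>. ?ev j \<omega> * ennreal (\<bar>walk n \<omega>\<bar> powr p) \<partial>S)" if "j < n" for j
  proof -
    \<comment> \<open>The event is decided by the first j steps, so it comes out of the integral
      over the later ones, in which Jensen replaces \<open>walk j\<close> by
      \<open>walk n\<close>.\<close>
    have ev_comb: "?ev j (comb_seq j \<omega> \<omega>') = ?ev j \<omega>" for \<omega> \<omega>'
      using that by (simp add: indicator_def passage_upto_eq_iff walk_comb_seq_le)
    have "(\<integral>\<^sup>+\<omega>. ?ev j \<omega> * ennreal (real (n - j) powr p) \<partial>S)
        \<le> (\<integral>\<^sup>+\<omega>. ?ev j \<omega> * ennreal (\<bar>walk j \<omega>\<bar> powr p) \<partial>S)"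
    proof (intro nn_integral_mono)
      fix \<omega>
      show "?ev j \<omega> * ennreal (real (n - j) powr p) \<le> ?ev j \<omega> * ennreal (\<bar>walk j \<omega>\<bar> powr p)"
        using that assms p_ge_2
        by (auto simp: indicator_def passage_upto_eq_iff intro!: ennreal_leI powr_mono2)
    qed
    also have "\<dots> \<le> (\<integral>\<^sup>+\<omega>. ?ev j \<omega> * (\<integral>\<^sup>+\<omega>'. ennreal (\<bar>walk j \<omega> + walk (n - j) \<omega>'\<bar> powr p) \<partial>S) \<partial>S)"
      by (intro nn_integral_mono mult_left_mono abs_powr_le_nn_integral_walk) auto
    also have "\<dots> = (\<integral>\<^sup>+\<omega>. \<integral>\<^sup>+\<omega>'. ?ev j (comb_seq j \<omega> \<omega>')
        * ennreal (\<bar>walk (j + (n - j)) (comb_seq j \<omega> \<omega>')\<bar> powr p) \<partial>S \<partial>S)"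
      unfolding ev_comb walk_comb_seq_add by (intro nn_integral_cong nn_integral_cmult[symmetric]) auto
    also have "\<dots> = (\<integral>\<^sup>+\<omega>. ?ev j \<omega> * ennreal (\<bar>walk n \<omega>\<bar> powr p) \<partial>S)"
      using that by (subst nn_integral_comb_seq[of _ j, symmetric]) auto
    finally show ?thesis .
  qed
  have "(\<integral>\<^sup>+\<omega>. ennreal (real (n - passage_upto n x \<omega>) powr p) \<partial>S)
      = (\<integral>\<^sup>+\<omega>. (\<Sum>j<n. ?ev j \<omega> * ennreal (real (n - j) powr p)) \<partial>S)"
  proof (intro nn_integral_cong)
    fix \<omega>
    show "ennreal (real (n - passage_upto n x \<omega>) powr p) = (\<Sum>j<n. ?ev j \<omega> * ennreal (real (n - j) powr p))"
      using passage_upto_le[of n x \<omega>] unfolding decomp by auto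
  qed
  also have "\<dots> = (\<Sum>j<n. \<integral>\<^sup>+\<omega>. ?ev j \<omega> * ennreal (real (n - j) powr p) \<partial>S)"
    by (intro nn_integral_sum) auto
  also have "\<dots> \<le> (\<Sum>j<n. \<integral>\<^sup>+\<omega>. ?ev j \<omega> * ennreal (\<bar>walk n \<omega>\<bar> powr p) \<partial>S)"
    by (intro sum_mono step) auto
  also have "\<dots> = (\<integral>\<^sup>+\<omega>. (\<Sum>j<n. ?ev j \<omega> * ennreal (\<bar>walk n \<omega>\<bar> powr p)) \<partial>S)"
    by (intro nn_integral_sum[symmetric]) auto
  also have "\<dots> \<le> (\<integral>\<^sup>+\<omega>. ennreal (\<bar>walk n \<omega>\<bar> powr p) \<partial>S)"
    unfolding decomp by (intro nn_integral_mono) auto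
  finally show ?thesis .
qed

text \<open>Restarting the walk at time \<open>m \<ge> x + b\<close> leaves a level whose \<open>p\<close>-th moment is of order
  \<open>m powr (p / 2)\<close>; for large \<open>b\<close> this is a small multiple of \<open>(x + b) powr p\<close>, so the induction on
  the truncation level closes with a constant independent of it.\<close>

lemma nn_integral_passage_upto_le:
  assumes b: "1 \<le> b" "2 powr p * 2 * 2 powr (p / 2) * moment_const p * s \<le> b powr (p / 2)"
    and "0 \<le> x"
  shows "(\<integral>\<^sup>+\<omega>. ennreal (real (passage_upto N x \<omega>) powr p) \<partial>S) \<le> ennreal (2 * 4 powr p * (x + b) powr p)"
  using \<open>0 \<le> x\<close>
proof (induction N arbitrary: x)
  case 0
  have "passage_upto 0 x \<omega> = 0" for \<omega>
    using passage_upto_le[of 0 x \<omega>] by simp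
  then show ?case using p_ge_2 by simp
next
  case (Suc N)
  \<comment> \<open>m >= x + b makes the residual level plus b at most |walk m|, and m >= 1 lets the
    cap drop from \<open>Suc N\<close> to N.\<close>
  define m where "m = nat \<lceil>x + b\<rceil>"
  have m_ceiling: "real m = of_int \<lceil>x + b\<rceil>"
    using Suc.prems b(1) by (simp add: m_def)
  have m: "x + b \<le> real m" "real m \<le> 2 * (x + b)"
    using Suc.prems b(1) ceiling_correct[of "x + b"] unfolding m_ceiling by auto
  have m1: "1 \<le> m"
    using m b(1) Suc.prems by linarith
  have restart: "(\<integral>\<^sup>+\<omega>'. ennreal (real (passage_upto N (x - m - walk m \<omega>) \<omega>') powr p) \<partial>S)
      \<le> ennreal (2 * 4 powr p) * ennreal (\<bar>walk m \<omega>\<bar> powr p)" for \<omega>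
  proof (cases "0 \<le> x - m - walk m \<omega>")
    case True
    have "(\<integral>\<^sup>+\<omega>'. ennreal (real (passage_upto N (x - m - walk m \<omega>) \<omega>') powr p) \<partial>S)
        \<le> ennreal (2 * 4 powr p * (x - m - walk m \<omega> + b) powr p)"
      using True by (rule Suc.IH)
    also have "\<dots> \<le> ennreal (2 * 4 powr p * \<bar>walk m \<omega>\<bar> powr p)"
      using True m b p_ge_2 by (intro ennreal_leI mult_left_mono powr_mono2) auto
    finally show ?thesis by (simp add: ennreal_mult)
  qed (simp add: passage_upto_neg)
  have "(\<integral>\<^sup>+\<omega>. ennreal (real (passage_upto (Suc N) x \<omega>) powr p) \<partial>S)
      = (\<integral>\<^sup>+\<omega>. \<integral>\<^sup>+\<omega>'. ennreal (real (passage_upto (Suc N) x (comb_seq m \<omega> \<omega>')) powr p) \<partial>S \<partial>S)"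
    by (rule nn_integral_comb_seq) simp
  also have "\<dots> \<le> (\<integral>\<^sup>+\<omega>. \<integral>\<^sup>+\<omega>'. ennreal ((real m + real (passage_upto N (x - m - walk m \<omega>) \<omega>')) powr p) \<partial>S \<partial>S)"
  proof (intro nn_integral_mono ennreal_leI powr_mono2)
    fix \<omega> \<omega>'
    have "passage_upto (Suc N) x (comb_seq m \<omega> \<omega>') \<le> m + passage_upto N (x - m - walk m \<omega>) \<omega>'"
      using m1 by (intro passage_upto_comb_seq_le) simp
    then show "real (passage_upto (Suc N) x (comb_seq m \<omega> \<omega>')) \<le> real m + real (passage_upto N (x - m - walk m \<omega>) \<omega>')"
      by linarith
  qed (use p_ge_2 in auto)
  also have "\<dots> \<le> (\<integral>\<^sup>+\<omega>. ennreal (2 powr p) * (ennreal (real m powr p)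
      + (\<integral>\<^sup>+\<omega>'. ennreal (real (passage_upto N (x - m - walk m \<omega>) \<omega>') powr p) \<partial>S)) \<partial>S)"
    using p_ge_2 by (intro nn_integral_mono nn_integral_powr_add_le P.prob_space_axioms) auto
  also have "\<dots> \<le> (\<integral>\<^sup>+\<omega>. ennreal (2 powr p) * (ennreal (real m powr p)
      + ennreal (2 * 4 powr p) * ennreal (\<bar>walk m \<omega>\<bar> powr p)) \<partial>S)"
    by (intro nn_integral_mono mult_left_mono add_left_mono restart) auto
  also have "\<dots> = ennreal (2 powr p) * (ennreal (real m powr p)
      + ennreal (2 * 4 powr p) * (\<integral>\<^sup>+\<omega>. ennreal (\<bar>walk m \<omega>\<bar> powr p) \<partial>S))"
    by (simp add: nn_integral_cmult nn_integral_add P.emeasure_space_1)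
  also have "\<dots> \<le> ennreal (2 powr p) * (ennreal (real m powr p)
      + ennreal (2 * 4 powr p) * ennreal (moment_const p * s * m powr (p / 2)))"
    by (intro mult_left_mono add_left_mono nn_integral_walk_le) auto
  also have "\<dots> = ennreal (2 powr p * real m powr p + 2 * 4 powr p * (2 powr p * moment_const p * s * m powr (p / 2)))"
    using moment_const_pos[of p] s_nonneg by (simp add: algebra_simps flip: ennreal_mult ennreal_plus)
  also have "\<dots> \<le> ennreal (2 * 4 powr p * (x + b) powr p)"
  proof (rule ennreal_leI)
    \<comment> \<open>Each summand may use half of 2 * 4^p (x + b)^p. In the condition on b, 2^p
      stems from splitting the power of a sum, 2^(p/2) from m <= 2 (x + b), and the factor 2 from
      the constant 2 * 4^p of the induction hypothesis, of which only half is available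
      here.\<close>
    have "real m powr p \<le> (2 * (x + b)) powr p"
      using m p_ge_2 by (intro powr_mono2) auto
    also have "\<dots> = 2 powr p * (x + b) powr p"
      by (rule powr_mult)
    finally have "2 powr p * real m powr p \<le> 2 powr p * (2 powr p * (x + b) powr p)"
      by (intro mult_left_mono) auto
    then have 1: "2 powr p * real m powr p \<le> 4 powr p * (x + b) powr p"
      using powr_mult[of 2 2 p] by (simp add: mult.assoc)
    have "real m powr (p / 2) \<le> (2 * (x + b)) powr (p / 2)"
      using m p_ge_2 by (intro powr_mono2) auto
    also have "\<dots> = 2 powr (p / 2) * (x + b) powr (p / 2)"
      by (rule powr_mult)
    finally have "2 * (2 powr p * moment_const p * s * m powr (p / 2))
        \<le> 2 * (2 powr p * moment_const p * s * (2 powr (p / 2) * (x + b) powr (p / 2)))"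
      using moment_const_pos[of p] s_nonneg by (intro mult_left_mono) auto
    also have "\<dots> = (2 powr p * 2 * 2 powr (p / 2) * moment_const p * s) * (x + b) powr (p / 2)"
      by (simp only: mult_ac)
    also have "\<dots> \<le> b powr (p / 2) * (x + b) powr (p / 2)"
      by (intro mult_right_mono b) auto
    also have "\<dots> \<le> (x + b) powr (p / 2) * (x + b) powr (p / 2)"
      using Suc.prems b p_ge_2 by (intro mult_right_mono powr_mono2) auto
    also have "\<dots> = (x + b) powr p"
      by (simp flip: powr_add)
    finally have 2: "2 * (2 powr p * moment_const p * s * m powr (p / 2)) \<le> (x + b) powr p" .
    have "2 * 4 powr p * (2 powr p * moment_const p * s * m powr (p / 2))
        = 4 powr p * (2 * (2 powr p * moment_const p * s * m powr (p / 2)))"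
      by (simp only: mult_ac)
    also have "\<dots> \<le> 4 powr p * (x + b) powr p"
      by (intro mult_left_mono 2) auto
    finally have 3: "2 * 4 powr p * (2 powr p * moment_const p * s * m powr (p / 2)) \<le> 4 powr p * (x + b) powr p" .
    have "4 powr p * (x + b) powr p + 4 powr p * (x + b) powr p = 2 * 4 powr p * (x + b) powr p"
      by simp
    with add_mono[OF 1 3]
    show "2 powr p * real m powr p + 2 * 4 powr p * (2 powr p * moment_const p * s * m powr (p / 2))
        \<le> 2 * 4 powr p * (x + b) powr p"
      by (simp only:)
  qed
  finally show ?case .
qed

text \<open>A restart at n leaves a level of at most 1 + |walk n|, to which the preceding growth
  bound applies; below level 0 nothing remains. The subtraction is that of natural numbers, hence a
  positive part. The bound is free of N, which allows the passage to the limit.\<close>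

lemma nn_integral_late_passage_le:
  assumes b: "1 \<le> b" "2 powr p * 2 * 2 powr (p / 2) * moment_const p * s \<le> b powr (p / 2)"
    and n: "x \<le> real n + 1"
  shows "(\<integral>\<^sup>+\<omega>. ennreal (real (passage_upto N x \<omega> - n) powr p) \<partial>S)
    \<le> ennreal (2 * 8 powr p * ((b + 1) powr p + moment_const p * s * n powr (p / 2)))"
proof -
  have restart: "(\<integral>\<^sup>+\<omega>'. ennreal (real (passage_upto N (x - n - walk n \<omega>) \<omega>') powr p) \<partial>S)
      \<le> ennreal (2 * 4 powr p) * ennreal ((b + 1 + \<bar>walk n \<omega>\<bar>) powr p)" for \<omega>
  proof (cases "0 \<le> x - n - walk n \<omega>")
    case True
    have "(\<integral>\<^sup>+\<omega>'. ennreal (real (passage_upto N (x - n - walk n \<omega>) \<omega>') powr p) \<partial>S)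
        \<le> ennreal (2 * 4 powr p * (x - n - walk n \<omega> + b) powr p)"
      using True by (rule nn_integral_passage_upto_le[OF b])
    also have "\<dots> \<le> ennreal (2 * 4 powr p * (b + 1 + \<bar>walk n \<omega>\<bar>) powr p)"
      using True n b p_ge_2 by (intro ennreal_leI mult_left_mono powr_mono2) auto
    finally show ?thesis by (simp add: ennreal_mult)
  qed (simp add: passage_upto_neg)
  have "(\<integral>\<^sup>+\<omega>. ennreal (real (passage_upto N x \<omega> - n) powr p) \<partial>S)
      = (\<integral>\<^sup>+\<omega>. \<integral>\<^sup>+\<omega>'. ennreal (real (passage_upto N x (comb_seq n \<omega> \<omega>') - n) powr p) \<partial>S \<partial>S)"
    by (rule nn_integral_comb_seq) simp
  also have "\<dots> \<le> (\<integral>\<^sup>+\<omega>. \<integral>\<^sup>+\<omega>'. ennreal (real (passage_upto N (x - n - walk n \<omega>) \<omega>') powr p) \<partial>S \<partial>S)"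
  proof (intro nn_integral_mono ennreal_leI powr_mono2)
    fix \<omega> \<omega>'
    have "passage_upto N x (comb_seq n \<omega> \<omega>') \<le> n + passage_upto N (x - n - walk n \<omega>) \<omega>'"
      by (intro passage_upto_comb_seq_le) simp
    then show "real (passage_upto N x (comb_seq n \<omega> \<omega>') - n) \<le> real (passage_upto N (x - n - walk n \<omega>) \<omega>')"
      by linarith
  qed (use p_ge_2 in auto)
  also have "\<dots> \<le> (\<integral>\<^sup>+\<omega>. ennreal (2 * 4 powr p) * ennreal ((b + 1 + \<bar>walk n \<omega>\<bar>) powr p) \<partial>S)"
    by (intro nn_integral_mono restart)
  also have "\<dots> = ennreal (2 * 4 powr p) * (\<integral>\<^sup>+\<omega>. ennreal ((b + 1 + \<bar>walk n \<omega>\<bar>) powr p) \<partial>S)"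
    by (intro nn_integral_cmult) auto
  also have "\<dots> \<le> ennreal (2 * 4 powr p) * (ennreal (2 powr p) * (ennreal ((b + 1) powr p)
      + (\<integral>\<^sup>+\<omega>. ennreal (\<bar>walk n \<omega>\<bar> powr p) \<partial>S)))"
    using b p_ge_2 by (intro mult_left_mono nn_integral_powr_add_le P.prob_space_axioms) auto
  also have "\<dots> \<le> ennreal (2 * 4 powr p) * (ennreal (2 powr p) * (ennreal ((b + 1) powr p)
      + ennreal (moment_const p * s * n powr (p / 2))))"
    by (intro mult_left_mono add_left_mono nn_integral_walk_le) auto
  also have "\<dots> = ennreal (2 * (4 powr p * 2 powr p) * ((b + 1) powr p + moment_const p * s * n powr (p / 2)))"
    using moment_const_pos[of p] s_nonneg by (simp add: mult_ac flip: ennreal_mult ennreal_plus)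
  also have "4 powr p * 2 powr p = 8 powr p"
    using powr_mult[of 4 2 p] by simp
  finally show ?thesis .
qed

text \<open>Up to a rounding error of at most 1, |nu - T| splits at n = floor T into an early and a
  late positive part. The early part only sees the passage time capped at n. The late part is the
  supremum over all caps, which is infinite on paths that never pass, so one estimate covers these
  too.\<close>

lemma nn_integral_passage_deviation_le:
  assumes b: "1 \<le> b" "2 powr p * 2 * 2 powr (p / 2) * moment_const p * s \<le> b powr (p / 2)"
    and "1 \<le> T"
  shows "(\<integral>\<^sup>+\<omega>. (case first_passage (\<lambda>n \<omega>. walk n \<omega> + real n) T \<omega> of
        \<infinity> \<Rightarrow> \<infinity> | enat k \<Rightarrow> ennreal (\<bar>real k - T\<bar> powr p)) \<partial>S)
    \<le> ennreal (32 powr p * 4 * ((b + 1) powr p + moment_const p * s * T powr (p / 2)))"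
proof -
  define n where "n = nat \<lfloor>T\<rfloor>"
  have n: "real n \<le> T" "T \<le> real n + 1"
    using \<open>1 \<le> T\<close> unfolding n_def by linarith+
  let ?early = "\<lambda>\<omega>. ennreal (real (n - passage_upto n T \<omega>) powr p)"
  let ?late = "\<lambda>N \<omega>. ennreal (real (passage_upto N T \<omega> - n) powr p)"
  have pointwise: "(case first_passage (\<lambda>n \<omega>. walk n \<omega> + real n) T \<omega> of
        \<infinity> \<Rightarrow> \<infinity> | enat k \<Rightarrow> ennreal (\<bar>real k - T\<bar> powr p))
      \<le> ennreal (4 powr p) * (1 + ?early \<omega> + (SUP N. ?late N \<omega>))" (is "?L \<le> ?R") for \<omega>
  proof (cases "first_passage (\<lambda>n \<omega>. walk n \<omega> + real n) T \<omega>")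
    case (enat k)
    note [simp] = first_passage_enat[OF enat]
    have "\<bar>real k - T\<bar> powr p \<le> (1 + (real (n - k) + real (k - n))) powr p"
      using n p_ge_2 by (intro powr_mono2) auto
    also have "\<dots> \<le> 2 powr p * (1 powr p + (real (n - k) + real (k - n)) powr p)"
      using p_ge_2 by (intro powr_add_le) auto
    also have "\<dots> \<le> 2 powr p * (2 powr p * 1 + 2 powr p * (real (n - k) powr p + real (k - n) powr p))"
      using p_ge_2 by (intro mult_left_mono add_mono powr_add_le) (auto intro!: ge_one_powr_ge_zero)
    also have "\<dots> = 4 powr p * (1 + real (n - k) powr p + real (k - n) powr p)"
      using powr_mult[of 2 2 p] by (simp add: algebra_simps)
    finally have "?L \<le> ennreal (4 powr p * (1 + real (n - k) powr p + real (k - n) powr p))"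
      by (simp add: enat ennreal_leI)
    also have "\<dots> = ennreal (4 powr p) * (1 + ennreal (real (n - k) powr p) + ennreal (real (k - n) powr p))"
      by (simp add: ennreal_mult flip: ennreal_plus ennreal_1)
    also have "ennreal (real (n - k) powr p) = ?early \<omega>"
      by (cases "k \<le> n") auto
    \<comment> \<open>The cap N = k is already exact, as \<open>passage_upto k\<close> is then
      k.\<close>
    also have "ennreal (real (k - n) powr p) = ?late k \<omega>"
      by simp
    also have "ennreal (4 powr p) * (1 + ?early \<omega> + ?late k \<omega>) \<le> ?R"
      by (intro mult_left_mono add_left_mono SUP_upper) auto
    finally show ?thesis .
  next
    case infinity
    \<comment> \<open>Here every cap is attained, so with cap n + N the late part is N^p, at least N
      since p >= 1.\<close>
    have "(SUP N. of_nat N) \<le> (SUP N. ?late N \<omega>)"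
    proof (rule SUP_least)
      fix N :: nat
      have "real N \<le> real N powr p"
        using powr_mono[of 1 p "real N"] p_ge_2 by (cases "N = 0") auto
      then have "of_nat N \<le> ?late (n + N) \<omega>"
        by (simp add: first_passage_infinity[OF infinity] ennreal_leI ennreal_of_nat_eq_real_of_nat)
      also have "\<dots> \<le> (SUP N. ?late N \<omega>)"
        by (rule SUP_upper) simp
      finally show "of_nat N \<le> (SUP N. ?late N \<omega>)" .
    qed
    then have late_top: "(SUP N. ?late N \<omega>) = top"
      by (simp only: ennreal_SUP_of_nat_eq_top top_unique)
    show ?thesis
      unfolding late_top by (simp add: ennreal_mult_eq_top_iff)
  qed
  have early: "(\<integral>\<^sup>+\<omega>. ?early \<omega> \<partial>S) \<le> ennreal (moment_const p * s * T powr (p / 2))"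
  proof -
    have "(\<integral>\<^sup>+\<omega>. ?early \<omega> \<partial>S) \<le> ennreal (moment_const p * s * n powr (p / 2))"
      using nn_integral_early_passage_le[OF n(1)] nn_integral_walk_le by (rule order_trans)
    also have "\<dots> \<le> ennreal (moment_const p * s * T powr (p / 2))"
      using n p_ge_2 moment_const_pos[of p] s_nonneg by (intro ennreal_leI mult_left_mono powr_mono2) auto
    finally show ?thesis .
  qed
  have late: "(\<integral>\<^sup>+\<omega>. (SUP N. ?late N \<omega>) \<partial>S)
      \<le> ennreal (2 * 8 powr p * ((b + 1) powr p + moment_const p * s * T powr (p / 2)))"
  proof -
    have "incseq (\<lambda>N \<omega>. ?late N \<omega>)"
      using passage_upto_mono[of T] p_ge_2
      by (auto simp: incseq_def le_fun_def intro!: ennreal_leI powr_mono2 diff_le_mono)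
    then have "(\<integral>\<^sup>+\<omega>. (SUP N. ?late N \<omega>) \<partial>S) = (SUP N. \<integral>\<^sup>+\<omega>. ?late N \<omega> \<partial>S)"
      by (intro nn_integral_monotone_convergence_SUP) auto
    also have "\<dots> \<le> ennreal (2 * 8 powr p * ((b + 1) powr p + moment_const p * s * n powr (p / 2)))"
      by (intro SUP_least nn_integral_late_passage_le b n)
    also have "\<dots> \<le> ennreal (2 * 8 powr p * ((b + 1) powr p + moment_const p * s * T powr (p / 2)))"
      using n p_ge_2 moment_const_pos[of p] s_nonneg
      by (intro ennreal_leI mult_left_mono add_left_mono powr_mono2) auto
    finally show ?thesis .
  qed
  let ?c = "(b + 1) powr p + moment_const p * s * T powr (p / 2)"
  have c: "1 \<le> (b + 1) powr p" "0 \<le> moment_const p * s * T powr (p / 2)"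
    using b p_ge_2 moment_const_pos[of p] s_nonneg by (auto intro!: ge_one_powr_ge_zero)
  have "(\<integral>\<^sup>+\<omega>. (case first_passage (\<lambda>n \<omega>. walk n \<omega> + real n) T \<omega> of
        \<infinity> \<Rightarrow> \<infinity> | enat k \<Rightarrow> ennreal (\<bar>real k - T\<bar> powr p)) \<partial>S)
      \<le> (\<integral>\<^sup>+\<omega>. ennreal (4 powr p) * (1 + ?early \<omega> + (SUP N. ?late N \<omega>)) \<partial>S)"
    by (intro nn_integral_mono pointwise)
  also have "\<dots> = ennreal (4 powr p) * (1 + (\<integral>\<^sup>+\<omega>. ?early \<omega> \<partial>S) + (\<integral>\<^sup>+\<omega>. (SUP N. ?late N \<omega>) \<partial>S))"
    by (simp add: nn_integral_cmult nn_integral_add P.emeasure_space_1)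
  also have "\<dots> \<le> ennreal (4 powr p) * (1 + ennreal (moment_const p * s * T powr (p / 2)) + ennreal (2 * 8 powr p * ?c))"
    by (intro mult_left_mono add_mono early late) auto
  also have "\<dots> = ennreal (4 powr p * (1 + moment_const p * s * T powr (p / 2) + 2 * 8 powr p * ?c))"
    using c by (simp flip: ennreal_plus ennreal_1 ennreal_mult)
  also have "\<dots> \<le> ennreal (4 powr p * (8 powr p * 4 * ?c))"
  proof (intro ennreal_leI mult_left_mono)
    have "1 + B + 2 * E * (A + B) \<le> E * 4 * (A + B)" if "1 \<le> A" "0 \<le> B" "1 \<le> E" for A B E :: real
      using mult_right_mono[of 1 E "A + B"] that by (simp add: algebra_simps)
    then show "1 + moment_const p * s * T powr (p / 2) + 2 * 8 powr p * ?c \<le> 8 powr p * 4 * ?c"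
      using c p_ge_2 by (simp add: ge_one_powr_ge_zero)
  qed auto
  also have "4 powr p * (8 powr p * 4 * ?c) = 32 powr p * 4 * ?c"
    using powr_mult[of 4 8 p] by (simp add: mult.assoc)
  finally show ?thesis .
qed

end

subsection \<open>Walks with drift\<close>

lemma random_walk_measurable:
  assumes "random_walk M S"
  shows "S n \<in> borel_measurable M"
proof (induction n)
  case 0
  have "(\<lambda>_. 0 :: real) \<in> borel_measurable M" by simp
  then show ?case
    using assms measurable_cong[of M "S 0" "\<lambda>_. 0" borel] by (simp add: random_walk_def)
next
  case (Suc n)
  interpret prob_space M using assms by (simp add: random_walk_def)
  have "(\<lambda>\<omega>. S (Suc n) \<omega> - S n \<omega>) \<in> borel_measurable M"
    using assms by (auto simp: random_walk_def indep_vars_def)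
  from borel_measurable_add[OF this Suc] show ?case by simp
qed

text \<open>Transfer to the canonical space: independence and the common law say that the sequence
  of normalised steps has the product law, and division by \<delta> turns the level t into T =
  t/\<delta>. The integrand is infinite where there is no passage, so the two integrals agree
  without knowing that the passage time is finite.\<close>

lemma nn_integral_first_passage_le:
  assumes walk: "walk_with_drift M S \<delta>" and \<delta>: "0 < \<delta>" "\<delta> \<le> t" and p: "2 \<le> p"
    and int: "integrable M (\<lambda>\<omega>. \<bar>S 1 \<omega> - \<delta>\<bar> powr p)"
    and s: "(\<integral>\<omega>. \<bar>S 1 \<omega> - \<delta>\<bar> powr p \<partial>M) \<le> s * \<delta> powr p"
    and b: "1 \<le> b" "2 powr p * 2 * 2 powr (p / 2) * moment_const p * s \<le> b powr (p / 2)"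
  shows "(\<integral>\<^sup>+\<omega>. (case first_passage S t \<omega> of \<infinity> \<Rightarrow> \<infinity> | enat k \<Rightarrow> ennreal (\<bar>real k - t / \<delta>\<bar> powr p)) \<partial>M)
    \<le> ennreal (32 powr p * 4 * ((b + 1) powr p + moment_const p * s * (t / \<delta>) powr (p / 2)))"
proof -
  have rw: "random_walk M S"
    using walk by (simp add: walk_with_drift_def)
  interpret prob_space M using rw by (simp add: random_walk_def)
  note M_prob_space = prob_space
  note [measurable] = random_walk_measurable[OF rw]
  define Y where "Y i \<omega> = (S (Suc i) \<omega> - S i \<omega>) / \<delta> - 1" for i \<omega>
  have Y_meas [measurable]: "Y i \<in> borel_measurable M" for i
    unfolding Y_def by measurable
  define \<mu> where "\<mu> = distr M borel (Y 0)"
  have S0: "S 0 \<omega> = 0" if "\<omega> \<in> space M" for \<omega>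
    using rw that by (simp add: random_walk_def)
  have Y0: "Y 0 \<omega> = S 1 \<omega> / \<delta> - 1" if "\<omega> \<in> space M" for \<omega>
    using S0[OF that] by (simp add: Y_def)
  have distr_Y: "distr M borel (Y i) = \<mu>" for i
  proof -
    have eq: "distr M borel (Y i) = distr (distr M borel (S 1)) borel (\<lambda>x. x / \<delta> - 1)" for i
    proof -
      have "distr (distr M borel (\<lambda>\<omega>. S (Suc i) \<omega> - S i \<omega>)) borel (\<lambda>x. x / \<delta> - 1) = distr M borel (Y i)"
        by (subst distr_distr) (auto simp: Y_def[abs_def] comp_def)
      moreover have "distr M borel (\<lambda>\<omega>. S (Suc i) \<omega> - S i \<omega>) = distr M borel (S 1)"
        using rw by (simp add: random_walk_def)
      ultimately show ?thesis by simp
    qed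
    show ?thesis unfolding \<mu>_def by (simp only: eq)
  qed
  have "indep_vars (\<lambda>_. borel) Y UNIV"
    unfolding Y_def using rw
    by (intro indep_vars_compose2[where Y = "\<lambda>_ x. x / \<delta> - 1"]) (auto simp: random_walk_def)
  then have distr_seq: "distr M (\<Pi>\<^sub>M i\<in>UNIV. borel) (\<lambda>\<omega> i. Y i \<omega>) = (\<Pi>\<^sub>M i\<in>UNIV. \<mu>)"
    by (subst (asm) indep_vars_iff_distr_eq_PiM) (auto simp: distr_Y restrict_UNIV)
  have mean: "(\<integral>\<omega>. S 1 \<omega> \<partial>M) = \<delta>" and int1: "integrable M (S 1)"
    using walk by (auto simp: walk_with_drift_def)
  have moment: "\<bar>Y 0 \<omega>\<bar> powr p = \<bar>S 1 \<omega> - \<delta>\<bar> powr p / \<delta> powr p" if "\<omega> \<in> space M" for \<omega>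
  proof -
    have "\<bar>Y 0 \<omega>\<bar> = \<bar>S 1 \<omega> - \<delta>\<bar> / \<delta>"
      using \<delta> by (simp add: Y0[OF that] field_simps flip: abs_div_pos)
    then show ?thesis by (simp add: powr_divide)
  qed
  interpret product_prob_space "\<lambda>_. \<mu>" "UNIV :: nat set"
    unfolding \<mu>_def by (intro product_prob_spaceI prob_space_distr) simp
  interpret centered_steps \<mu> p s
  proof (unfold_locales)
    show "sets \<mu> = sets borel" by (simp add: \<mu>_def)
    have "integrable M (Y 0)"
      using int1 Y0 Bochner_Integration.integrable_cong[of M M "Y 0" "\<lambda>\<omega>. S 1 \<omega> / \<delta> - 1"] by simp
    then show "integrable \<mu> (\<lambda>x. x)"
      by (simp add: \<mu>_def integrable_distr_eq)
    have "(\<integral>\<omega>. Y 0 \<omega> \<partial>M) = (\<integral>\<omega>. S 1 \<omega> / \<delta> - 1 \<partial>M)"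
      by (intro Bochner_Integration.integral_cong Y0) auto
    then show "(\<integral>x. x \<partial>\<mu>) = 0"
      using int1 mean \<delta> by (simp add: \<mu>_def integral_distr M_prob_space)
    have "integrable M (\<lambda>\<omega>. \<bar>Y 0 \<omega>\<bar> powr p)"
      using int moment Bochner_Integration.integrable_cong[of M M "\<lambda>\<omega>. \<bar>Y 0 \<omega>\<bar> powr p"
        "\<lambda>\<omega>. \<bar>S 1 \<omega> - \<delta>\<bar> powr p / \<delta> powr p"] by simp
    then show "integrable \<mu> (\<lambda>x. \<bar>x\<bar> powr p)"
      by (simp add: \<mu>_def integrable_distr_eq)
    have "(\<integral>\<omega>. \<bar>Y 0 \<omega>\<bar> powr p \<partial>M) = (\<integral>\<omega>. \<bar>S 1 \<omega> - \<delta>\<bar> powr p / \<delta> powr p \<partial>M)"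
      by (intro Bochner_Integration.integral_cong moment) auto
    also have "\<dots> \<le> s"
      using s \<delta> by (simp add: field_simps)
    finally show "(\<integral>x. \<bar>x\<bar> powr p \<partial>\<mu>) \<le> s"
      by (simp add: \<mu>_def integral_distr)
  qed (rule p)
  let ?\<phi> = "\<lambda>\<nu>. case \<nu> of \<infinity> \<Rightarrow> \<infinity> | enat k \<Rightarrow> ennreal (\<bar>real k - t / \<delta>\<bar> powr p)"
  have S_eq: "S n \<omega> = \<delta> * (walk n (\<lambda>i. Y i \<omega>) + real n)" if "\<omega> \<in> space M" for n \<omega>
  proof (induction n)
    case (Suc n)
    have "S (Suc n) \<omega> = S n \<omega> + \<delta> * (Y n \<omega> + 1)"
      using \<delta> by (simp add: Y_def)
    then show ?case using Suc by (simp add: walk_Suc algebra_simps)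
  qed (simp add: S0[OF that])
  have passage_eq: "first_passage S t \<omega> = first_passage (\<lambda>n \<omega>. walk n \<omega> + real n) (t / \<delta>) (\<lambda>i. Y i \<omega>)"
    if "\<omega> \<in> space M" for \<omega>
    using \<delta> by (simp add: first_passage_def S_eq[OF that] divide_less_eq mult.commute)
  have [measurable]: "first_passage (\<lambda>n \<omega>. walk n \<omega> + real n) (t / \<delta>) \<in> PiM UNIV (\<lambda>_. borel) \<rightarrow>\<^sub>M count_space UNIV"
    by (rule measurable_first_passage) simp
  have [measurable]: "?\<phi> \<in> count_space UNIV \<rightarrow>\<^sub>M borel" by simp
  have "(\<integral>\<^sup>+\<omega>. ?\<phi> (first_passage S t \<omega>) \<partial>M)
      = (\<integral>\<^sup>+\<omega>. ?\<phi> (first_passage (\<lambda>n \<omega>. walk n \<omega> + real n) (t / \<delta>) (\<lambda>i. Y i \<omega>)) \<partial>M)"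
    by (intro nn_integral_cong) (simp only: passage_eq)
  also have "\<dots> = (\<integral>\<^sup>+\<omega>. ?\<phi> (first_passage (\<lambda>n \<omega>. walk n \<omega> + real n) (t / \<delta>) \<omega>)
      \<partial>distr M (\<Pi>\<^sub>M i\<in>UNIV. borel) (\<lambda>\<omega> i. Y i \<omega>))"
    by (intro nn_integral_distr[symmetric]) (auto intro!: measurable_PiM_single' measurable_compose[OF _ \<open>?\<phi> \<in> _\<close>])
  also have "\<dots> \<le> ennreal (32 powr p * 4 * ((b + 1) powr p + moment_const p * s * (t / \<delta>) powr (p / 2)))"
    unfolding distr_seq using \<delta> by (intro nn_integral_passage_deviation_le b) simp
  finally show ?thesis .
qed

text \<open>A pointwise substitute for Lyapunov's inequality: if the p-th moment of z is at most K
  l^p, integration bounds its r-th moment by (1 + K) l^r.\<close>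

lemma powr_interpolation_le:
  fixes z l r p :: real
  assumes "0 \<le> z" "0 < l" "0 \<le> r" "r \<le> p"
  shows "z powr r \<le> l powr r + l powr (r - p) * z powr p"
proof (cases "z \<le> l")
  case True
  then have "z powr r \<le> l powr r"
    using assms by (intro powr_mono2) auto
  then show ?thesis
    by (rule order_trans) simp
next
  case False
  then have "z powr r = z powr (r - p) * z powr p"
    using assms by (simp flip: powr_add)
  also have "\<dots> \<le> l powr (r - p) * z powr p"
    using False assms by (intro mult_right_mono powr_mono2') auto
  finally show ?thesis
    by (rule order_trans) simp
qed

lemma scaled_passage_eq:
  assumes "0 < t"
  shows "scaled_passage S (\<delta>, t) \<omega> - 1 = (case first_passage (S \<delta>) t \<omega> of
    \<infinity> \<Rightarrow> ereal \<delta> * \<infinity> - 1 | enat k \<Rightarrow> ereal (\<delta> * real k / t - 1))"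
  using assms by (cases "first_passage (S \<delta>) t \<omega>") (auto simp: scaled_passage_def one_ereal_def ereal_divide)

lemma abs_moment_scaled_passage_le:
  fixes S :: "real \<Rightarrow> nat \<Rightarrow> 'a \<Rightarrow> real"
  assumes walk: "walk_with_drift M (S \<delta>) \<delta>" and \<delta>: "0 < \<delta>" "\<delta> \<le> t"
    and p: "2 \<le> p" and r: "0 \<le> r" "r \<le> p"
    and int: "integrable M (\<lambda>\<omega>. \<bar>S \<delta> 1 \<omega> - \<delta>\<bar> powr p)"
    and C: "(\<integral>\<omega>. \<bar>S \<delta> 1 \<omega> - \<delta>\<bar> powr p \<partial>M) \<le> C * \<delta> powr p"
    and c: "(\<integral>\<omega>. \<bar>S \<delta> 1 \<omega> - \<delta>\<bar> powr p \<partial>M) \<le> c * \<delta> powr q" "0 \<le> c"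
    and b: "1 \<le> b" "2 powr p * 2 * 2 powr (p / 2) * moment_const p * C \<le> b powr (p / 2)"
    and \<alpha>: "\<alpha> = 2 * q / p - 1"
  shows "abs_moment M r (\<lambda>\<omega>. scaled_passage S (\<delta>, t) \<omega> - 1)
    \<le> ennreal ((1 + 32 powr p * 4 * ((b + 1) powr p + moment_const p * c)) * 2 powr r
        * ((\<delta> / t) powr r + (\<delta> powr \<alpha> / t) powr (r / 2)))"
proof -
  define m where "m = (\<integral>\<omega>. \<bar>S \<delta> 1 \<omega> - \<delta>\<bar> powr p \<partial>M)"
  define s where "s = m / \<delta> powr p"
  \<comment> \<open>\<open>u\<close> is the scale of the bounded part of the error in nu,
    \<open>v\<close> that of the fluctuations of the walk. Interpolating at their sum gives both
    rates at once.\<close>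
  define u where "u = \<delta> / t"
  define v where "v = (\<delta> powr \<alpha> / t) powr (1 / 2)"
  define l where "l = u + v"
  define K where "K = 32 powr p * 4 * ((b + 1) powr p + moment_const p * c)"
  have rw: "random_walk M (S \<delta>)"
    using walk by (simp add: walk_with_drift_def)
  interpret prob_space M using rw by (simp add: random_walk_def)
  have t: "0 < t" using \<delta> by simp
  have u: "0 < u" and v: "0 < v" and l: "0 < l"
    using \<delta> t by (auto simp: u_def v_def l_def add_pos_nonneg)
  have s: "0 \<le> s" "s \<le> C" "s \<le> c * \<delta> powr (q - p)"
    using C c \<delta> by (auto simp: s_def m_def field_simps powr_diff)
  have K: "0 \<le> K"
    using c moment_const_pos[of p] by (simp add: K_def)
  have u_p: "(\<delta> / t) powr p * (t / \<delta>) powr (p / 2) = (\<delta> / t) powr (p / 2)"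
  proof -
    have "(\<delta> / t) powr p = (\<delta> / t) powr (p / 2) * (\<delta> / t) powr (p / 2)"
      by (simp flip: powr_add)
    moreover have "(\<delta> / t) powr (p / 2) * (t / \<delta>) powr (p / 2) = 1"
      using \<delta> t by (simp flip: powr_mult)
    ultimately show ?thesis by simp
  qed
  \<comment> \<open>This identity is the origin of \<alpha>: the normalised step moment is of order
    \<delta>^(q - p), the diffusive factor is (\<delta>/t)^(p/2), and \<alpha> p/2 = (q - p) +
    p/2.\<close>
  have v_p: "v powr p = \<delta> powr (q - p) * (\<delta> / t) powr (p / 2)"
  proof -
    have "v powr p = (\<delta> powr \<alpha> / t) powr (p / 2)"
      by (simp add: v_def powr_powr)
    also have "\<dots> = \<delta> powr (\<alpha> * (p / 2)) / t powr (p / 2)"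
      by (simp add: powr_divide powr_powr)
    also have "\<alpha> * (p / 2) = (q - p) + p / 2"
      using p by (simp add: \<alpha> field_simps)
    finally show ?thesis
      by (simp only: powr_add powr_divide times_divide_eq_right)
  qed
  have "2 powr p * 2 * 2 powr (p / 2) * moment_const p * s \<le> 2 powr p * 2 * 2 powr (p / 2) * moment_const p * C"
    using s moment_const_pos[of p] by (intro mult_left_mono) auto
  note b' = order_trans[OF this b(2)]
  let ?\<phi> = "\<lambda>\<omega>. case first_passage (S \<delta>) t \<omega> of \<infinity> \<Rightarrow> \<infinity> | enat k \<Rightarrow> ennreal (\<bar>real k - t / \<delta>\<bar> powr p)"
  have fp [measurable]: "first_passage (S \<delta>) t \<in> M \<rightarrow>\<^sub>M count_space UNIV"
    by (intro measurable_first_passage random_walk_measurable rw)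
  have \<phi>_meas: "?\<phi> \<in> borel_measurable M"
    by (rule measurable_compose[OF fp]) simp
  have "(\<integral>\<^sup>+\<omega>. ?\<phi> \<omega> \<partial>M)
      \<le> ennreal (32 powr p * 4 * ((b + 1) powr p + moment_const p * s * (t / \<delta>) powr (p / 2)))"
    using \<delta> by (intro nn_integral_first_passage_le[OF walk _ _ p int _ b(1) b']) (auto simp: s_def m_def)
  then have "ennreal (u powr p) * (\<integral>\<^sup>+\<omega>. ?\<phi> \<omega> \<partial>M)
      \<le> ennreal (u powr p) * ennreal (32 powr p * 4 * ((b + 1) powr p + moment_const p * s * (t / \<delta>) powr (p / 2)))"
    by (rule mult_left_mono) simp
  also have "\<dots> = ennreal (32 powr p * 4 * ((b + 1) powr p * u powr p
      + moment_const p * (s * ((\<delta> / t) powr p * (t / \<delta>) powr (p / 2)))))"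
    using s moment_const_pos[of p] by (simp add: u_def algebra_simps flip: ennreal_mult)
  also have "\<dots> \<le> ennreal (K * l powr p)"
  proof (rule ennreal_leI)
    have "s * ((\<delta> / t) powr p * (t / \<delta>) powr (p / 2)) \<le> c * v powr p"
      unfolding u_p v_p using mult_right_mono[OF s(3), of "(\<delta> / t) powr (p / 2)"] by (simp add: mult.assoc)
    also have "\<dots> \<le> c * l powr p"
      using c u v p by (intro mult_left_mono powr_mono2) (auto simp: l_def)
    finally have 1: "moment_const p * (s * ((\<delta> / t) powr p * (t / \<delta>) powr (p / 2))) \<le> moment_const p * (c * l powr p)"
      using moment_const_pos[of p] by (intro mult_left_mono) auto
    have 2: "(b + 1) powr p * u powr p \<le> (b + 1) powr p * l powr p"
      using u v p by (intro mult_left_mono powr_mono2) (auto simp: l_def)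
    have "K * l powr p = 32 powr p * 4 * ((b + 1) powr p * l powr p + moment_const p * (c * l powr p))"
      by (simp add: K_def algebra_simps)
    then show "32 powr p * 4 * ((b + 1) powr p * u powr p
        + moment_const p * (s * ((\<delta> / t) powr p * (t / \<delta>) powr (p / 2)))) \<le> K * l powr p"
      using mult_left_mono[OF add_mono[OF 2 1], of "32 powr p * 4"] by simp
  qed
  finally have main: "ennreal (u powr p) * (\<integral>\<^sup>+\<omega>. ?\<phi> \<omega> \<partial>M) \<le> ennreal (K * l powr p)" .
  have pointwise: "(if \<bar>scaled_passage S (\<delta>, t) \<omega> - 1\<bar> = \<infinity> then \<infinity>
        else ennreal (\<bar>real_of_ereal (scaled_passage S (\<delta>, t) \<omega> - 1)\<bar> powr r))
      \<le> ennreal (l powr r) + ennreal (l powr (r - p)) * (ennreal (u powr p) * ?\<phi> \<omega>)" for \<omega>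
  proof (cases "first_passage (S \<delta>) t \<omega>")
    case (enat k)
    define z where "z = \<bar>\<delta> * real k / t - 1\<bar>"
    have "z = u * \<bar>real k - t / \<delta>\<bar>"
      using \<delta> t by (simp add: z_def u_def field_simps flip: abs_mult_pos)
    then have "u powr p * \<bar>real k - t / \<delta>\<bar> powr p = z powr p"
      by (simp add: powr_mult)
    moreover have "ennreal (z powr r) \<le> ennreal (l powr r + l powr (r - p) * z powr p)"
      using r l by (intro ennreal_leI powr_interpolation_le) (auto simp: z_def)
    ultimately show ?thesis
      using t by (simp add: scaled_passage_eq enat z_def flip: ennreal_mult)
  next
    case infinity
    \<comment> \<open>In \<open>ennreal\<close>, 0 times infinity is 0; the right-hand side is
      infinite because u and l are positive.\<close>
    then show ?thesis
      using u l by (simp add: ennreal_mult_eq_top_iff)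
  qed
  have "abs_moment M r (\<lambda>\<omega>. scaled_passage S (\<delta>, t) \<omega> - 1)
      \<le> (\<integral>\<^sup>+\<omega>. ennreal (l powr r) + ennreal (l powr (r - p)) * (ennreal (u powr p) * ?\<phi> \<omega>) \<partial>M)"
    unfolding abs_moment_def by (intro nn_integral_mono pointwise)
  also have "\<dots> = ennreal (l powr r) + ennreal (l powr (r - p)) * (ennreal (u powr p) * (\<integral>\<^sup>+\<omega>. ?\<phi> \<omega> \<partial>M))"
    using \<phi>_meas by (simp add: nn_integral_add nn_integral_cmult emeasure_space_1)
  also have "\<dots> \<le> ennreal (l powr r) + ennreal (l powr (r - p)) * ennreal (K * l powr p)"
    by (intro add_left_mono mult_left_mono main) simp
  also have "\<dots> = ennreal (l powr r + K * (l powr (r - p) * l powr p))"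
    using K by (simp add: mult_ac flip: ennreal_mult ennreal_plus)
  also have "l powr r + K * (l powr (r - p) * l powr p) = (1 + K) * l powr r"
    by (simp add: algebra_simps flip: powr_add)
  also have "\<dots> \<le> (1 + K) * (2 powr r * (u powr r + v powr r))"
    unfolding l_def using u v r K by (intro mult_left_mono powr_add_le) auto
  also have "\<dots> = (1 + K) * 2 powr r * ((\<delta> / t) powr r + (\<delta> powr \<alpha> / t) powr (r / 2))"
    by (simp add: u_def v_def powr_powr)
  finally show ?thesis
    by (simp add: K_def ennreal_leI)
qed

subsection \<open>Joint limits\<close>

lemma joint_limit_eventually_drift:
  assumes "joint_limit D F" "eventually P (drift_limit D)"
  shows "\<forall>\<^sub>F (\<delta>, t) in F. P \<delta>"
proof -
  from assms(2) have "eventually (\<lambda>\<delta>. \<delta> \<in> D \<longrightarrow> P \<delta>) at_top"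
    by (simp add: drift_limit_def eventually_inf_principal)
  moreover have "filterlim fst at_top F"
    using assms(1) by (simp add: joint_limit_def)
  ultimately have "\<forall>\<^sub>F x in F. fst x \<in> D \<longrightarrow> P (fst x)"
    unfolding filterlim_iff by blast
  moreover have "\<forall>\<^sub>F x in F. fst x \<in> D"
    using assms(1) by (simp add: joint_limit_def split_beta')
  ultimately show ?thesis
    by eventually_elim auto
qed

text \<open>The constant 1 in \<delta> = o(t) gives \<delta> <= t, which puts the normalised level
  t/\<delta> into the range T >= 1 of the deviation bound.\<close>

lemma joint_limit_eventually_le:
  assumes "joint_limit D F"
  shows "\<forall>\<^sub>F (\<delta>, t) in F. \<delta> \<in> D \<and> 0 < \<delta> \<and> \<delta> \<le> t"
proof -
  have "\<forall>\<^sub>F x in F. 0 < fst x" "\<forall>\<^sub>F x in F. 0 < snd x"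
    using assms by (auto simp: joint_limit_def filterlim_at_top_dense)
  moreover have "\<forall>\<^sub>F x in F. norm (fst x) \<le> 1 * norm (snd x)"
    using assms by (intro landau_o.smallD) (auto simp: joint_limit_def)
  moreover have "\<forall>\<^sub>F x in F. fst x \<in> D"
    using assms by (simp add: joint_limit_def split_beta')
  ultimately show ?thesis
    by eventually_elim auto
qed

text \<open>Supplies the finiteness clause of \<open>tendsto_Lp\<close>, which concerns X itself,
  from estimates for X - 1.\<close>

lemma abs_moment_le_centered:
  assumes "prob_space M" "0 \<le> r" and [measurable]: "X \<in> borel_measurable M"
  shows "abs_moment M r X \<le> ennreal (2 powr r) * (1 + abs_moment M r (\<lambda>\<omega>. X \<omega> - 1))"
proof -
  interpret prob_space M by fact
  let ?e = "\<lambda>x::ereal. if \<bar>x\<bar> = \<infinity> then \<infinity> else ennreal (\<bar>real_of_ereal x\<bar> powr r)"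
  have pointwise: "?e x \<le> ennreal (2 powr r) * (1 + ?e (x - 1))" for x :: ereal
  proof (cases x)
    case (real y)
    have "\<bar>y\<bar> powr r \<le> (1 + \<bar>y - 1\<bar>) powr r"
      using assms by (intro powr_mono2) auto
    also have "\<dots> \<le> 2 powr r * (1 powr r + \<bar>y - 1\<bar> powr r)"
      using assms by (intro powr_add_le) auto
    finally have "ennreal (\<bar>y\<bar> powr r) \<le> ennreal (2 powr r * (1 + \<bar>y - 1\<bar> powr r))"
      by (simp add: ennreal_leI)
    also have "\<dots> = ennreal (2 powr r) * (1 + ennreal (\<bar>y - 1\<bar> powr r))"
      by (simp add: ennreal_mult flip: ennreal_1 ennreal_plus)
    finally show ?thesis
      by (simp add: real one_ereal_def)
  next
    case PInf
    then show ?thesis by (simp add: ennreal_mult_eq_top_iff)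
  next
    case MInf
    have "- \<infinity> - (1 :: ereal) = - \<infinity>"
      by (simp add: one_ereal_def)
    with MInf show ?thesis by (simp add: ennreal_mult_eq_top_iff)
  qed
  have "abs_moment M r X \<le> (\<integral>\<^sup>+\<omega>. ennreal (2 powr r) * (1 + ?e (X \<omega> - 1)) \<partial>M)"
    unfolding abs_moment_def by (intro nn_integral_mono pointwise)
  also have "\<dots> = ennreal (2 powr r) * (1 + abs_moment M r (\<lambda>\<omega>. X \<omega> - 1))"
    unfolding abs_moment_def by (simp add: nn_integral_cmult nn_integral_add emeasure_space_1)
  finally show ?thesis .
qed

lemma measurable_scaled_passage:
  assumes "random_walk M (S \<delta>)"
  shows "scaled_passage S (\<delta>, t) \<in> borel_measurable M"
proof -
  have "first_passage (S \<delta>) t \<in> M \<rightarrow>\<^sub>M count_space UNIV"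
    by (intro measurable_first_passage random_walk_measurable assms)
  from measurable_compose[OF this, of "\<lambda>n. ereal \<delta> * ereal_of_enat n / ereal t" borel]
  show ?thesis by (simp add: scaled_passage_def)
qed

text \<open>K is chosen before the filter: it depends on r, p and the bounds along
  \<open>drift_limit D\<close>, so one constant serves every joint limit.\<close>

lemma scaled_passage_moment_bound:
  fixes D :: "real set" and M :: "real \<Rightarrow> 'a measure" and \<tau> :: "real \<Rightarrow> nat \<Rightarrow> 'a \<Rightarrow> real"
  assumes walk: "\<And>\<delta>. \<delta> \<in> D \<Longrightarrow> walk_with_drift (M \<delta>) (\<tau> \<delta>) \<delta>"
    and p: "2 \<le> p" and r: "0 \<le> r" "r \<le> p"
    and int: "\<forall>\<^sub>F \<delta> in drift_limit D. integrable (M \<delta>) (\<lambda>\<omega>. \<bar>\<tau> \<delta> 1 \<omega> - \<delta>\<bar> powr p)"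
    and bigo: "(\<lambda>\<delta>. \<integral>\<omega>. \<bar>\<tau> \<delta> 1 \<omega> - \<delta>\<bar> powr p \<partial>M \<delta>) \<in> O[drift_limit D](\<lambda>\<delta>. \<delta> powr p)"
    and bigo_q: "(\<lambda>\<delta>. \<integral>\<omega>. \<bar>\<tau> \<delta> 1 \<omega> - \<delta>\<bar> powr p \<partial>M \<delta>) \<in> O[drift_limit D](\<lambda>\<delta>. \<delta> powr q)"
    and \<alpha>: "\<alpha> = 2 * q / p - 1"
  obtains K where "0 \<le> K" "\<forall>F. joint_limit D F \<longrightarrow> (\<forall>\<^sub>F (\<delta>, t) in F.
    abs_moment (M \<delta>) r (\<lambda>\<omega>. scaled_passage \<tau> (\<delta>, t) \<omega> - 1)
      \<le> ennreal (K * ((\<delta> / t) powr r + (\<delta> powr \<alpha> / t) powr (r / 2))))"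
proof -
  obtain C where C: "\<forall>\<^sub>F \<delta> in drift_limit D. (\<integral>\<omega>. \<bar>\<tau> \<delta> 1 \<omega> - \<delta>\<bar> powr p \<partial>M \<delta>) \<le> C * \<delta> powr p"
    using landau_o.bigE[OF bigo] by (auto simp: abs_of_nonneg)
  obtain c where c: "0 < c" "\<forall>\<^sub>F \<delta> in drift_limit D. (\<integral>\<omega>. \<bar>\<tau> \<delta> 1 \<omega> - \<delta>\<bar> powr p \<partial>M \<delta>) \<le> c * \<delta> powr q"
    using landau_o.bigE[OF bigo_q] by (auto simp: abs_of_nonneg)
  define Q where "Q = 2 powr p * 2 * 2 powr (p / 2) * moment_const p * C"
  \<comment> \<open>By construction b^(p/2) >= |Q|; the absolute value is taken because the sign of
    \<open>C\<close> is not recorded.\<close>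
  define b where "b = max 1 (\<bar>Q\<bar> powr (2 / p))"
  have b: "1 \<le> b" "Q \<le> b powr (p / 2)"
  proof -
    have "Q \<le> (\<bar>Q\<bar> powr (2 / p)) powr (p / 2)"
      using p by (simp add: powr_powr)
    also have "\<dots> \<le> b powr (p / 2)"
      using p by (intro powr_mono2) (auto simp: b_def)
    finally show "Q \<le> b powr (p / 2)" .
  qed (simp add: b_def)
  define K where "K = (1 + 32 powr p * 4 * ((b + 1) powr p + moment_const p * c)) * 2 powr r"
  show thesis
  proof (rule that[of K], goal_cases)
    case 1
    show "0 \<le> K"
      using c moment_const_pos[of p] by (simp add: K_def)
  next
    case 2
    show ?case
    proof (intro allI impI)
      fix F assume F: "joint_limit D F"
      have "\<forall>\<^sub>F \<delta> in drift_limit D. integrable (M \<delta>) (\<lambda>\<omega>. \<bar>\<tau> \<delta> 1 \<omega> - \<delta>\<bar> powr p)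
        \<and> (\<integral>\<omega>. \<bar>\<tau> \<delta> 1 \<omega> - \<delta>\<bar> powr p \<partial>M \<delta>) \<le> C * \<delta> powr p
        \<and> (\<integral>\<omega>. \<bar>\<tau> \<delta> 1 \<omega> - \<delta>\<bar> powr p \<partial>M \<delta>) \<le> c * \<delta> powr q"
        by (intro eventually_conj int C c)
      from joint_limit_eventually_drift[OF F this] joint_limit_eventually_le[OF F]
      show "\<forall>\<^sub>F (\<delta>, t) in F. abs_moment (M \<delta>) r (\<lambda>\<omega>. scaled_passage \<tau> (\<delta>, t) \<omega> - 1)
        \<le> ennreal (K * ((\<delta> / t) powr r + (\<delta> powr \<alpha> / t) powr (r / 2)))"
      proof eventually_elim
        case (elim x)
        obtain \<delta> t where x: "x = (\<delta>, t)" by force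
        show ?case
          using elim c b unfolding x split K_def
          by (intro abs_moment_scaled_passage_le[where C = C and q = q] walk p r \<alpha>) (auto simp: Q_def)
      qed
    qed
  qed
qed

text \<open>A sum of two O-terms is stated as an equality, so an upper bound has to become an exact
  decomposition. The quotient \<theta> of A by a + b is eventually at most K and A = \<theta> a +
  \<theta> b; the witnesses are the roots of these two parts, nonnegative everywhere because
  \<open>powr\<close> is.\<close>

lemma exact_two_term_rate:
  assumes "0 < r" "0 \<le> K" and F: "joint_limit D F"
    and bound: "\<forall>\<^sub>F (\<delta>, t) in F. A (\<delta>, t) \<le> ennreal (K * ((\<delta> / t) powr r + (\<delta> powr \<alpha> / t) powr (r / 2)))"
  shows "\<exists>f g :: real \<times> real \<Rightarrow> real. (\<forall>x. f x \<ge> 0 \<and> g x \<ge> 0) \<and>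
    f \<in> O[F](\<lambda>(\<delta>, t). \<delta> / t) \<and> g \<in> O[F](\<lambda>(\<delta>, t). \<delta> powr \<alpha> / t) \<and>
    (\<forall>\<^sub>F (\<delta>, t) in F. A (\<delta>, t) = ennreal (f (\<delta>, t) powr r + g (\<delta>, t) powr (r / 2)))"
proof -
  define a where "a = (\<lambda>(\<delta>, t). (\<delta> / t) powr r)"
  define b where "b = (\<lambda>(\<delta>, t). (\<delta> powr \<alpha> / t) powr (r / 2))"
  define \<theta> where "\<theta> x = enn2real (A x) / (a x + b x)" for x
  define f where "f x = (\<theta> x * a x) powr (1 / r)" for x
  define g where "g x = (\<theta> x * b x) powr (2 / r)" for x
  have nonneg: "0 \<le> a x" "0 \<le> b x" "0 \<le> \<theta> x" for x
    by (auto simp: a_def b_def \<theta>_def split: prod.split)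
  have good: "\<forall>\<^sub>F x in F. 0 < fst x \<and> 0 < snd x \<and> \<theta> x \<le> K \<and> A x = ennreal (\<theta> x * (a x + b x))"
    using bound joint_limit_eventually_le[OF F]
  proof eventually_elim
    case (elim x)
    obtain \<delta> t where x: "x = (\<delta>, t)" by force
    have pos: "0 < a x + b x"
      using elim by (auto simp: x a_def b_def intro!: add_pos_nonneg)
    have A: "A x \<le> ennreal (K * (a x + b x))"
      using elim by (simp add: x a_def b_def)
    then have "enn2real (A x) \<le> K * (a x + b x)"
      using assms nonneg[of x] by (intro enn2real_leI) auto
    then have "\<theta> x \<le> K"
      using pos by (simp add: \<theta>_def field_simps)
    moreover have "A x < top"
      using A by (rule order_le_less_trans) simp
    then have "A x = ennreal (\<theta> x * (a x + b x))"
      using pos by (simp add: \<theta>_def)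
    ultimately show ?case using elim by (auto simp: x)
  qed
  have "f \<in> O[F](\<lambda>(\<delta>, t). \<delta> / t)"
  proof (rule bigoI[where c = "K powr (1 / r)"])
    from good show "\<forall>\<^sub>F x in F. norm (f x) \<le> K powr (1 / r) * norm (case x of (\<delta>, t) \<Rightarrow> \<delta> / t)"
    proof eventually_elim
      case (elim x)
      have "f x \<le> (K * a x) powr (1 / r)"
        unfolding f_def using elim nonneg[of x] \<open>0 < r\<close> by (intro powr_mono2 mult_right_mono) auto
      also have "\<dots> = K powr (1 / r) * (fst x / snd x)"
        using elim \<open>0 < r\<close> by (simp add: powr_mult a_def split_beta' powr_powr)
      finally show ?case
        using elim by (simp add: f_def split_beta')
    qed
  qed
  moreover have "g \<in> O[F](\<lambda>(\<delta>, t). \<delta> powr \<alpha> / t)"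
  proof (rule bigoI[where c = "K powr (2 / r)"])
    from good show "\<forall>\<^sub>F x in F. norm (g x) \<le> K powr (2 / r) * norm (case x of (\<delta>, t) \<Rightarrow> \<delta> powr \<alpha> / t)"
    proof eventually_elim
      case (elim x)
      have "g x \<le> (K * b x) powr (2 / r)"
        unfolding g_def using elim nonneg[of x] \<open>0 < r\<close> by (intro powr_mono2 mult_right_mono) auto
      also have "\<dots> = K powr (2 / r) * (fst x powr \<alpha> / snd x)"
        using elim \<open>0 < r\<close> by (simp add: powr_mult b_def split_beta' powr_powr)
      finally show ?case
        using elim by (simp add: g_def split_beta')
    qed
  qed
  moreover have "\<forall>\<^sub>F (\<delta>, t) in F. A (\<delta>, t) = ennreal (f (\<delta>, t) powr r + g (\<delta>, t) powr (r / 2))"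
    using good
  proof eventually_elim
    case (elim x)
    have "f x powr r + g x powr (r / 2) = \<theta> x * (a x + b x)"
      using nonneg[of x] \<open>0 < r\<close> by (simp add: f_def g_def powr_powr distrib_left)
    with elim show ?case by (simp add: split_beta' del: ennreal_plus)
  qed
  ultimately show ?thesis
    by (intro exI[of _ f] exI[of _ g]) (auto simp: f_def g_def)
qed

theorem theorem2p2:
  fixes D :: "real set"
    and M :: "real \<Rightarrow> 'a measure"
    and \<tau> :: "real \<Rightarrow> nat \<Rightarrow> 'a \<Rightarrow> real"
    and r :: real
  assumes "D \<subseteq> {0<..}"
    and "\<And>\<delta>. \<delta> \<in> D \<Longrightarrow> walk_with_drift (M \<delta>) (\<tau> \<delta>) \<delta>"
    and "r \<ge> 1"
    and "\<forall>\<^sub>F \<delta> in drift_limit D. integrable (M \<delta>) (\<lambda>\<omega>. \<bar>\<tau> \<delta> 1 \<omega> - \<delta>\<bar> powr max r 2)"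
    and "(\<lambda>\<delta>. \<integral>\<omega>. \<bar>\<tau> \<delta> 1 \<omega> - \<delta>\<bar> powr max r 2 \<partial>M \<delta>) \<in> O[drift_limit D](\<lambda>\<delta>. \<delta> powr max r 2)"
    and "\<forall>\<^sub>F \<delta> in drift_limit D. integrable (M \<delta>) (\<lambda>\<omega>. max (\<tau> \<delta> 1 \<omega>) 0 powr (r + 1))"
    and "(\<lambda>\<delta>. \<integral>\<omega>. max (\<tau> \<delta> 1 \<omega>) 0 powr (r + 1) \<partial>M \<delta>) \<in> O[drift_limit D](\<lambda>\<delta>. \<delta> powr (r + 1))"
  shows "(\<forall>F. joint_limit D F \<longrightarrow>
            tendsto_Lp r (\<lambda>(\<delta>, t). M \<delta>) (scaled_passage \<tau>) 1 F) \<and>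
         (\<forall>q \<alpha>. 0 \<le> q \<and> q \<le> max r 2 \<and> \<alpha> = 2 * q / max r 2 - 1 \<and>
            (\<lambda>\<delta>. \<integral>\<omega>. \<bar>\<tau> \<delta> 1 \<omega> - \<delta>\<bar> powr max r 2 \<partial>M \<delta>) \<in> \<Theta>[drift_limit D](\<lambda>\<delta>. \<delta> powr q) \<longrightarrow>
            (\<forall>F. joint_limit D F \<longrightarrow>
               (\<exists>f g :: real \<times> real \<Rightarrow> real.
                  (\<forall>x. f x \<ge> 0 \<and> g x \<ge> 0) \<and>
                  f \<in> O[F](\<lambda>(\<delta>, t). \<delta> / t) \<and>
                  g \<in> O[F](\<lambda>(\<delta>, t). \<delta> powr \<alpha> / t) \<and>
                  (\<forall>\<^sub>F (\<delta>, t) in F.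
                     abs_moment (M \<delta>) r (\<lambda>\<omega>. scaled_passage \<tau> (\<delta>, t) \<omega> - 1)
                       = ennreal (f (\<delta>, t) powr r + g (\<delta>, t) powr (r / 2))))))"
proof (intro conjI allI impI)
  have max: "2 \<le> max r 2" "0 \<le> r" "r \<le> max r 2"
    using \<open>1 \<le> r\<close> by auto
  {
    fix F assume F: "joint_limit D F"
    \<comment> \<open>Convergence is the case q = max r 2: then \<alpha> = 1, both terms are powers
      of \<delta>/t, and the same O-hypothesis serves as both moment bounds.\<close>
    have one: "(1::real) = 2 * max r 2 / max r 2 - 1" by simp
    obtain K where K: "0 \<le> K" and bound_all: "\<forall>F. joint_limit D F \<longrightarrow> (\<forall>\<^sub>F (\<delta>, t) in F.
        abs_moment (M \<delta>) r (\<lambda>\<omega>. scaled_passage \<tau> (\<delta>, t) \<omega> - 1)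
          \<le> ennreal (K * ((\<delta> / t) powr r + (\<delta> powr 1 / t) powr (r / 2))))"
      by (rule scaled_passage_moment_bound[OF assms(2) max assms(4,5,5) one])
    note bound = bound_all[rule_format, OF F]
    have "\<forall>\<^sub>F x in F. scaled_passage \<tau> x \<in> borel_measurable (case x of (\<delta>, t) \<Rightarrow> M \<delta>)
        \<and> abs_moment (case x of (\<delta>, t) \<Rightarrow> M \<delta>) r (scaled_passage \<tau> x) < \<infinity>"
      using bound joint_limit_eventually_le[OF F]
    proof eventually_elim
      case (elim x)
      obtain \<delta> t where x: "x = (\<delta>, t)" by force
      have rw: "random_walk (M \<delta>) (\<tau> \<delta>)"
        using assms(2)[of \<delta>] elim by (simp add: x walk_with_drift_def)
      note meas = measurable_scaled_passage[of "M \<delta>" \<tau> \<delta>, OF rw]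
      have "abs_moment (M \<delta>) r (scaled_passage \<tau> x)
          \<le> ennreal (2 powr r) * (1 + abs_moment (M \<delta>) r (\<lambda>\<omega>. scaled_passage \<tau> x \<omega> - 1))"
        using rw meas max unfolding x by (intro abs_moment_le_centered) (auto simp: random_walk_def)
      also have "\<dots> < \<infinity>"
      proof -
        have "abs_moment (M \<delta>) r (\<lambda>\<omega>. scaled_passage \<tau> x \<omega> - 1) < top"
          using elim(1) unfolding x split by (rule order_le_less_trans) simp
        then show ?thesis by (simp add: ennreal_mult_less_top)
      qed
      finally show ?case using meas by (simp add: x)
    qed
    moreover have "((\<lambda>x. abs_moment (case x of (\<delta>, t) \<Rightarrow> M \<delta>) r (\<lambda>\<omega>. scaled_passage \<tau> x \<omega> - ereal 1)) \<longlongrightarrow> 0) F"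
    proof (rule tendsto_sandwich[OF _ _ tendsto_const])
      have ratio: "((\<lambda>x. fst x / snd x) \<longlongrightarrow> 0) F"
        using F by (intro smalloD_tendsto) (simp add: joint_limit_def)
      have ratio_nonneg: "\<forall>\<^sub>F x in F. 0 \<le> fst x / snd x"
        using joint_limit_eventually_le[OF F] by eventually_elim auto
      have "((\<lambda>x. K * ((fst x / snd x) powr r + (fst x / snd x) powr (r / 2))) \<longlongrightarrow> K * (0 powr r + 0 powr (r / 2))) F"
        using \<open>1 \<le> r\<close> ratio_nonneg by (intro tendsto_intros tendsto_powr' ratio) auto
      from tendsto_ennrealI[OF this]
      show "((\<lambda>x. ennreal (K * ((fst x / snd x) powr r + (fst x / snd x) powr (r / 2)))) \<longlongrightarrow> 0) F"
        using \<open>1 \<le> r\<close> by (simp del: ennreal_mult' ennreal_mult'' ennreal_plus)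
      show "\<forall>\<^sub>F x in F. abs_moment (case x of (\<delta>, t) \<Rightarrow> M \<delta>) r (\<lambda>\<omega>. scaled_passage \<tau> x \<omega> - ereal 1)
          \<le> ennreal (K * ((fst x / snd x) powr r + (fst x / snd x) powr (r / 2)))"
        using bound joint_limit_eventually_le[OF F]
        by eventually_elim (auto simp: one_ereal_def[symmetric])
    qed simp
    ultimately show "tendsto_Lp r (\<lambda>(\<delta>, t). M \<delta>) (scaled_passage \<tau>) 1 F"
      unfolding tendsto_Lp_def by blast
  }
  fix q \<alpha> F
  assume q: "0 \<le> q \<and> q \<le> max r 2 \<and> \<alpha> = 2 * q / max r 2 - 1 \<and>
      (\<lambda>\<delta>. \<integral>\<omega>. \<bar>\<tau> \<delta> 1 \<omega> - \<delta>\<bar> powr max r 2 \<partial>M \<delta>) \<in> \<Theta>[drift_limit D](\<lambda>\<delta>. \<delta> powr q)"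
    and F: "joint_limit D F"
  from q have bigo_q: "(\<lambda>\<delta>. \<integral>\<omega>. \<bar>\<tau> \<delta> 1 \<omega> - \<delta>\<bar> powr max r 2 \<partial>M \<delta>) \<in> O[drift_limit D](\<lambda>\<delta>. \<delta> powr q)"
    and \<alpha>: "\<alpha> = 2 * q / max r 2 - 1"
    by (simp_all add: bigthetaD1)
  obtain K where K: "0 \<le> K" and bound_all: "\<forall>F. joint_limit D F \<longrightarrow> (\<forall>\<^sub>F (\<delta>, t) in F.
      abs_moment (M \<delta>) r (\<lambda>\<omega>. scaled_passage \<tau> (\<delta>, t) \<omega> - 1)
        \<le> ennreal (K * ((\<delta> / t) powr r + (\<delta> powr \<alpha> / t) powr (r / 2))))"
    by (rule scaled_passage_moment_bound[OF assms(2) max assms(4,5) bigo_q \<alpha>])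
  note bound = bound_all[rule_format, OF F]
  show "\<exists>f g :: real \<times> real \<Rightarrow> real.
      (\<forall>x. f x \<ge> 0 \<and> g x \<ge> 0) \<and>
      f \<in> O[F](\<lambda>(\<delta>, t). \<delta> / t) \<and>
      g \<in> O[F](\<lambda>(\<delta>, t). \<delta> powr \<alpha> / t) \<and>
      (\<forall>\<^sub>F (\<delta>, t) in F.
         abs_moment (M \<delta>) r (\<lambda>\<omega>. scaled_passage \<tau> (\<delta>, t) \<omega> - 1)
           = ennreal (f (\<delta>, t) powr r + g (\<delta>, t) powr (r / 2)))"
    using exact_two_term_rate[OF _ K F, of r
      "\<lambda>(\<delta>, t). abs_moment (M \<delta>) r (\<lambda>\<omega>. scaled_passage \<tau> (\<delta>, t) \<omega> - 1)" \<alpha>] bound \<open>1 \<le> r\<close>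
    by simp
qed

end
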